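(* Let $G$ and $H$ be two $n$-vertex graphs with vertex sets $\{u_1,\ldots,u_n\}$ and $\{v_1,\ldots,v_n\}$, respectively, and let $A(G)$ and $A(H)$ be their adjacency matrices with respect to these vertex orderings. Then the following are equivalent: (i) The rooted graphs $(G,u_n)$ and $(H,v_n)$ are generalized cospectral, i.e., the four graphs $G$, $\overline{G}$, $G-u_n$ and $\overline{G-u_n}$ are cospectral with $H$, $\overline{H}$, $H-v_n$ and $\overline{H-v_n}$, respectively. (ii) There exists a regular orthogonal matrix of the form $\begin{pmatrix} Q & O\\ O & 1\end{pmatrix}$ (with $Q$ of order $n-1$) such that $$\begin{pmatrix} Q^{\mathrm T} & O\\ O & 1\end{pmatrix} A(G) \begin{pmatrix} Q & O\\ O & 1\end{pmatrix} = A(H).$$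
   Context: Graphs are finite, simple and undirected. The adjacency matrix $A(G)$ of a graph $G$ with ordered vertex set $\{u_1,\ldots,u_n\}$ is the $n\times n$ $(0,1)$-matrix whose $(i,j)$ entry is $1$ iff $u_i$ and $u_j$ are adjacent. $\overline{G}$ denotes the complement of $G$, and $G-u$ denotes the subgraph obtained by deleting the vertex $u$. The spectrum of $G$ is the multiset of eigenvalues of $A(G)$; two graphs are cospectral if they have the same spectrum. Two graphs $G$ and $H$ are generalized cospectral if $G,H$ are cospectral and $\overline{G},\overline{H}$ are cospectral. Two rooted graphs $(G,u)$ and $(H,v)$ (graphs with a distinguished vertex) are generalized cospectral if $G$ and $H$ are generalized cospectral and $G-u$ and $H-v$ are generalized cospectral. A (real) orthogonal matrix is regular if each of its row sums equals $1$. *)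

theory Defs
  imports
    Complex_Main
    "HOL-Computational_Algebra.Fundamental_Theorem_Algebra"
    "Graph_Theory.Digraph"
    "Jordan_Normal_Form.Char_Poly"
begin

text \<open>
  A finite simple undirected graph is an instance of the locale \<^locale>\<open>graph\<close>:
  a finite, loop-free, symmetric digraph without parallel arcs. Two vertices are adjacent iff
  there is an arc from one to the other.
\<close>

definition graph_complement :: "('a, 'b) pre_digraph \<Rightarrow> ('a, 'a \<times> 'a) pre_digraph" where
  "graph_complement G =
     \<lparr> verts = verts G,
       arcs = {(u, v). u \<in> verts G \<and> v \<in> verts G \<and> u \<noteq> v \<and> \<not> u \<rightarrow>\<^bsub>G\<^esub> v},
       tail = fst, head = snd \<rparr>"

abbreviation delete_vertex :: "('a, 'b) pre_digraph \<Rightarrow> 'a \<Rightarrow> ('a, 'b) pre_digraph" where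
  "delete_vertex G u \<equiv> pre_digraph.del_vert G u"

definition vertex_ordering :: "('a, 'b) pre_digraph \<Rightarrow> 'a list \<Rightarrow> bool" where
  "vertex_ordering G us \<longleftrightarrow> distinct us \<and> set us = verts G"

definition adjacency_matrix :: "('a, 'b) pre_digraph \<Rightarrow> 'a list \<Rightarrow> 'c :: zero_neq_one mat" where
  "adjacency_matrix G us =
     mat (length us) (length us) (\<lambda>(i, j). if us ! i \<rightarrow>\<^bsub>G\<^esub> us ! j then 1 else 0)"

text \<open>
  Eigenvalues are counted with algebraic multiplicity. The matrix is read over the complex
  numbers, so that all its eigenvalues are counted; being real symmetric, it has only real ones.
  The choice of ordering is immaterial, see \<open>graph_spectrum_eq\<close> below.
\<close>
definition graph_spectrum :: "('a, 'b) pre_digraph \<Rightarrow> complex multiset" where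
  "graph_spectrum G = proots (char_poly (adjacency_matrix G (SOME us. vertex_ordering G us)))"

definition cospectral :: "('a, 'b) pre_digraph \<Rightarrow> ('c, 'd) pre_digraph \<Rightarrow> bool" where
  "cospectral G H \<longleftrightarrow> graph_spectrum G = graph_spectrum H"

definition generalized_cospectral :: "('a, 'b) pre_digraph \<Rightarrow> ('c, 'd) pre_digraph \<Rightarrow> bool" where
  "generalized_cospectral G H \<longleftrightarrow>
     cospectral G H \<and> cospectral (graph_complement G) (graph_complement H)"

definition rooted_generalized_cospectral ::
    "('a, 'b) pre_digraph \<times> 'a \<Rightarrow> ('c, 'd) pre_digraph \<times> 'c \<Rightarrow> bool" where
  "rooted_generalized_cospectral = (\<lambda>(G, u) (H, v).
     generalized_cospectral G H \<and>
     generalized_cospectral (delete_vertex G u) (delete_vertex H v))"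

text \<open>
  The constant \<^const>\<open>orthogonal_mat\<close> only asks for pairwise orthogonal nonzero columns;
  orthogonality in the usual sense means that the transpose is the inverse.
\<close>
definition regular_orthogonal_mat :: "real mat \<Rightarrow> bool" where
  "regular_orthogonal_mat A \<longleftrightarrow>
     square_mat A \<and> inverts_mat A (transpose_mat A) \<and> inverts_mat (transpose_mat A) A \<and>
     (\<forall>i < dim_row A. (\<Sum>j < dim_col A. A $$ (i, j)) = 1)"

definition bordered_mat :: "real mat \<Rightarrow> real mat" where
  "bordered_mat Q =
     four_block_mat Q (0\<^sub>m (dim_row Q) 1) (0\<^sub>m 1 (dim_col Q)) (1\<^sub>m 1)"

lemma graph_graph_complement:
  assumes "graph G"
  shows "graph (graph_complement G)"
proof -
  interpret graph G by fact
  have fin: "finite (arcs (graph_complement G))"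
    by (rule finite_subset[of _ "verts G \<times> verts G"]) (auto simp: graph_complement_def)
  have "symmetric (graph_complement G)"
    using arcs_ends_symmetric[OF sym_arcs]
    by (force simp: symmetric_conv graph_complement_def)
  then show ?thesis
    using fin by unfold_locales (auto simp: graph_complement_def arc_to_ends_def)
qed

lemma graph_delete_vertex:
  assumes "graph G"
  shows "graph (delete_vertex G u)"
proof -
  interpret graph G by fact
  interpret D: fin_digraph "delete_vertex G u" by (rule fin_digraph_del_vert)
  have "symmetric (delete_vertex G u)"
    using sym_arcs by (fastforce simp: symmetric_conv del_vert_simps)
  then show ?thesis
    using no_loops no_multi_arcs by unfold_locales (auto simp: del_vert_simps ends_del_vert)
qed

lemma char_poly_adjacency_matrix_reorder:
  assumes us: "vertex_ordering G us" and vs: "vertex_ordering G vs"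
  shows "char_poly (adjacency_matrix G us :: 'c :: idom mat) = char_poly (adjacency_matrix G vs)"
proof -
  define n where "n = length us"
  have mset: "mset vs = mset us"
    using us vs set_eq_iff_mset_eq_distinct[of vs us] by (simp add: vertex_ordering_def)
  then have len: "length vs = n"
    unfolding n_def by (rule mset_eq_length)
  obtain p where p: "p permutes {..<n}" and vs_eq: "permute_list p us = vs"
    using mset_eq_permutation[OF mset] by (auto simp: n_def)
  have p': "p permutes {0..<n}" using p by (simp add: atLeast0LessThan)
  have nth: "vs ! i = us ! p i" if "i < n" for i
    using that permute_list_nth[of p us i] p vs_eq by (simp add: n_def)
  have lt: "p i < n" if "i < n" for i
    using that permutes_in_image[OF p, of i] by simp
  have inj: "p i = p j \<longleftrightarrow> i = j" for i j
    using permutes_inj[OF p] by (auto dest: injD)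
  define A where "A = char_poly_matrix (adjacency_matrix G us :: 'c mat)"
  define B where "B = mat n n (\<lambda>(i, j). A $$ (p i, j))"
  have A: "A \<in> carrier_mat n n" and B: "B \<in> carrier_mat n n"
    by (auto simp: A_def B_def adjacency_matrix_def char_poly_matrix_def n_def)
  have BT: "transpose_mat B \<in> carrier_mat n n" using B by simp
  have reorder: "char_poly_matrix (adjacency_matrix G vs) =
      transpose_mat (mat n n (\<lambda>(i, j). transpose_mat B $$ (p i, j)))"
    by (rule eq_matI)
      (auto simp: A_def B_def adjacency_matrix_def char_poly_matrix_def nth lt inj len n_def[symmetric])
  have "char_poly (adjacency_matrix G vs :: 'c mat) =
      det (mat n n (\<lambda>(i, j). transpose_mat B $$ (p i, j)))"
    unfolding char_poly_def reorder by (rule det_transpose) auto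
  also have "\<dots> = signof p * det (transpose_mat B)"
    by (rule det_permute_rows[OF BT p'])
  also have "det (transpose_mat B) = det B"
    by (rule det_transpose[OF B])
  also have "det B = signof p * det A"
    unfolding B_def by (rule det_permute_rows[OF A p'])
  also have "signof p * (signof p * det A) = det A"
    by (simp add: sign_def)
  finally show ?thesis by (simp add: A_def char_poly_def)
qed

lemma graph_spectrum_eq:
  assumes "vertex_ordering G us"
  shows "graph_spectrum G = proots (char_poly (adjacency_matrix G us))"
  unfolding graph_spectrum_def
  by (rule arg_cong[where f = proots], rule char_poly_adjacency_matrix_reorder)
    (fact someI[of "vertex_ordering G", OF assms], fact assms)

end

theory Submission
  imports Defs
begin

text \<open>
  Write \<open>A(G)\<close> as a symmetric matrix \<open>A\<close> of order \<open>m = n - 1\<close> bordered by a vector \<open>b\<close>, and let \<open>e\<close>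
  be the all-ones vector. By Schur complements, the four characteristic polynomials determine the
  spectrum of \<open>A\<close> and the rational functions \<open>p = e\<^sup>T (s + A)\<^sup>-\<^sup>1 e\<close>,
  \<open>r = b\<^sup>T (s + A)\<^sup>-\<^sup>1 b\<close> and \<open>(1 - q)\<^sup>2\<close> with \<open>q = e\<^sup>T (s + A)\<^sup>-\<^sup>1 b\<close>;
  as \<open>q\<close> vanishes at infinity, also \<open>q\<close> itself. By partial fractions, for every eigenvalue the
  projections of \<open>e\<close> and \<open>b\<close> to the eigenspace have the same Gram matrix for \<open>G\<close> and for \<open>H\<close>.
  Two Householder reflections in each eigenspace then carry one pair of vectors to the other while
  commuting with the diagonalized matrix. The converse is invariance of the characteristic
  polynomials under regular orthogonal congruence.
\<close>

section \<open>Householder reflections within eigenspaces\<close>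

text \<open>In an eigenbasis with eigenvalues \<open>d\<close>, this is the inner product of the
  projections of \<open>u\<close> and \<open>w\<close> to the eigenspace of \<open>x\<close>. It is
  0 if \<open>x\<close> is not an eigenvalue, so \<open>x\<close> may range over all reals.\<close>

definition block_scalar_prod :: "(nat \<Rightarrow> real) \<Rightarrow> real \<Rightarrow> real vec \<Rightarrow> real vec \<Rightarrow> real" where
  "block_scalar_prod d x u w = (\<Sum>l | l < dim_vec w \<and> d l = x. u $ l * w $ l)"

definition diagonal :: "nat \<Rightarrow> (nat \<Rightarrow> real) \<Rightarrow> real mat" where
  "diagonal m d = mat m m (\<lambda>(i, j). if i = j then d i else 0)"

text \<open>On a block where \<open>w\<close> vanishes the divisor is \<open>0\<close>; as \<open>x / 0 = 0\<close>, the reflection is the identity there.\<close>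
definition block_reflection :: "(nat \<Rightarrow> real) \<Rightarrow> real vec \<Rightarrow> real mat" where
  "block_reflection d w = mat (dim_vec w) (dim_vec w) (\<lambda>(k, l). (if k = l then 1 else 0) -
     (if d k = d l then 2 * w $ k * w $ l / block_scalar_prod d (d k) w w else 0))"

lemma diagonal_carrier [simp]: "diagonal m d \<in> carrier_mat m m"
  by (simp add: diagonal_def)

lemma block_scalar_prod_commute:
  "dim_vec u = dim_vec w \<Longrightarrow> block_scalar_prod d x u w = block_scalar_prod d x w u"
  by (simp add: block_scalar_prod_def mult.commute)

lemma block_scalar_prod_diff_right:
  assumes "dim_vec v = dim_vec w"
  shows "block_scalar_prod d x u (v - w) = block_scalar_prod d x u v - block_scalar_prod d x u w"
  using assms by (simp add: block_scalar_prod_def sum_subtractf [symmetric] right_diff_distrib)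

lemma block_scalar_prod_diff_left:
  assumes "dim_vec u = dim_vec w" "dim_vec v = dim_vec w"
  shows "block_scalar_prod d x (u - v) w = block_scalar_prod d x u w - block_scalar_prod d x v w"
  using assms by (simp add: block_scalar_prod_def sum_subtractf [symmetric] left_diff_distrib)

lemma block_reflection_carrier [simp]:
  "w \<in> carrier_vec m \<Longrightarrow> block_reflection d w \<in> carrier_mat m m"
  by (auto simp: block_reflection_def)

lemma dim_block_reflection [simp]:
  "dim_row (block_reflection d w) = dim_vec w" "dim_col (block_reflection d w) = dim_vec w"
  by (auto simp: block_reflection_def)

lemma transpose_block_reflection [simp]: "(block_reflection d w)\<^sup>T = block_reflection d w"
  by (rule eq_matI) (auto simp: block_reflection_def)

lemma block_reflection_mult_vec:
  assumes "dim_vec u = dim_vec w" "k < dim_vec w"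
  shows "(block_reflection d w *\<^sub>v u) $ k =
    u $ k - 2 * w $ k * block_scalar_prod d (d k) w u / block_scalar_prod d (d k) w w"
proof -
  let ?N = "block_scalar_prod d (d k) w w"
  have "(block_reflection d w *\<^sub>v u) $ k = (\<Sum>l<dim_vec w. (if k = l then u $ l else 0) -
      (if d k = d l then 2 * w $ k * w $ l / ?N * u $ l else 0))"
    using assms by (auto simp: block_reflection_def scalar_prod_def atLeast0LessThan
        left_diff_distrib intro!: sum.cong)
  also have "\<dots> = u $ k - (\<Sum>l<dim_vec w. if d k = d l then 2 * w $ k * w $ l / ?N * u $ l else 0)"
    using assms by (simp add: sum_subtractf sum.delta')
  also have "(\<Sum>l<dim_vec w. if d k = d l then 2 * w $ k * w $ l / ?N * u $ l else 0) =
      (\<Sum>l | l < dim_vec w \<and> d l = d k. 2 * w $ k / ?N * (w $ l * u $ l))"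
    by (rule sum.mono_neutral_cong_right) auto
  also have "\<dots> = 2 * w $ k / ?N * block_scalar_prod d (d k) w u"
    by (simp add: sum_distrib_left block_scalar_prod_def assms)
  finally show ?thesis by simp
qed

text \<open>The quotient stays unreduced to cover both kinds of block: where \<open>w\<close> is
  nonzero the value is negated, and where \<open>w\<close> vanishes the division by 0 leaves it
  unchanged.\<close>

lemma block_scalar_prod_reflection:
  assumes dim: "dim_vec u = dim_vec w"
  shows "block_scalar_prod d x w (block_reflection d w *\<^sub>v u) =
    block_scalar_prod d x w u -
    2 * block_scalar_prod d x w w * block_scalar_prod d x w u / block_scalar_prod d x w w"
proof -
  let ?p = "block_scalar_prod d x"
  have "?p w (block_reflection d w *\<^sub>v u) =
    (\<Sum>l | l < dim_vec w \<and> d l = x. w $ l * u $ l - 2 * ?p w u / ?p w w * (w $ l * w $ l))"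
    unfolding block_scalar_prod_def [of d x w "_ *\<^sub>v _"]
    by (rule sum.cong) (auto simp: block_reflection_mult_vec dim algebra_simps simp del: index_mult_mat_vec)
  also have "\<dots> = ?p w u - 2 * ?p w u / ?p w w * ?p w w"
    unfolding sum_subtractf sum_distrib_left [symmetric] by (simp add: block_scalar_prod_def dim)
  finally show ?thesis by simp
qed

lemma block_reflection_involution:
  assumes w: "w \<in> carrier_vec m"
  shows "block_reflection d w * block_reflection d w = 1\<^sub>m m"
proof (rule mat_col_eqI)
  fix j assume "j < dim_col (1\<^sub>m m :: real mat)"
  then have j: "j < m" by simp
  let ?R = "block_reflection d w"
  have R: "?R \<in> carrier_mat m m" using w by simp
  have inv: "?R *\<^sub>v (?R *\<^sub>v u) = u" if u: "u \<in> carrier_vec m" for u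
  proof (rule eq_vecI)
    fix k assume k: "k < dim_vec u"
    show "(?R *\<^sub>v (?R *\<^sub>v u)) $ k = u $ k"
      using u w k by (simp add: block_reflection_mult_vec block_scalar_prod_reflection
          del: index_mult_mat_vec)
  qed (use u w in auto)
  have "col ?R j = ?R *\<^sub>v unit_vec m j"
    by (rule eq_vecI) (use w j in auto)
  then have "col (?R * ?R) j = ?R *\<^sub>v (?R *\<^sub>v unit_vec m j)"
    using col_mult2 [OF R R j] by simp
  then show "col (?R * ?R) j = col (1\<^sub>m m) j"
    using inv [of "unit_vec m j"] j by simp
qed (use w in auto)

text \<open>An off-diagonal entry of the reflection at \<open>(k, l)\<close> can be nonzero only if
  \<open>d k = d l\<close>, so scaling its row or its column has the same effect.\<close>

lemma block_reflection_commute: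
  assumes w: "w \<in> carrier_vec m"
  shows "block_reflection d w * diagonal m d = diagonal m d * block_reflection d w"
proof (rule eq_matI)
  fix i j assume "i < dim_row (diagonal m d * block_reflection d w)"
    and "j < dim_col (diagonal m d * block_reflection d w)"
  then have ij: "i < m" "j < m" using w by (auto simp: diagonal_def)
  have "(block_reflection d w * diagonal m d) $$ (i, j) = block_reflection d w $$ (i, j) * d j"
    using ij w by (simp add: diagonal_def scalar_prod_def if_distrib [of "\<lambda>x. _ * x"] cong: if_cong)
  moreover have "(diagonal m d * block_reflection d w) $$ (i, j) =
      d i * block_reflection d w $$ (i, j)"
    using ij w by (simp add: diagonal_def scalar_prod_def if_distrib [of "\<lambda>x. x * _"] cong: if_cong)
  ultimately show "(block_reflection d w * diagonal m d) $$ (i, j) =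
      (diagonal m d * block_reflection d w) $$ (i, j)"
    using ij w by (auto simp: block_reflection_def)
qed (use w in \<open>auto simp: diagonal_def\<close>)

text \<open>In each block, two vectors of equal length are exchanged by the reflection in the
  hyperplane orthogonal to their difference.\<close>

lemma block_reflection_swap:
  assumes a: "a \<in> carrier_vec m" and b: "b \<in> carrier_vec m"
    and eq: "\<And>x. block_scalar_prod d x a a = block_scalar_prod d x b b"
  shows "block_reflection d (b - a) *\<^sub>v b = a"
proof (rule eq_vecI)
  fix k assume "k < dim_vec a"
  then have k: "k < m" using a by simp
  let ?p = "block_scalar_prod d (d k)"
  have pb: "?p (b - a) b = ?p b b - ?p a b"
    using a b by (simp add: block_scalar_prod_diff_left)
  \<comment> \<open>Equality of the block norms makes the reflection coefficient equal to 1 whenever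
    the divisor is nonzero, so exactly \<open>b - a\<close> is subtracted from
    \<open>b\<close>.\<close>
  have N: "?p (b - a) (b - a) = 2 * ?p (b - a) b"
    unfolding pb using a b eq [of "d k"] block_scalar_prod_commute [of a b d "d k"]
    by (simp add: block_scalar_prod_diff_left block_scalar_prod_diff_right)
  show "(block_reflection d (b - a) *\<^sub>v b) $ k = a $ k"
  proof (cases "?p (b - a) (b - a) = 0")
    case True
    \<comment> \<open>A vanishing sum of squares makes \<open>a\<close> and \<open>b\<close> agree
      on the whole block, where the reflection is the identity.\<close>
    then have "\<forall>l \<in> {l. l < dim_vec (b - a) \<and> d l = d k}. (b - a) $ l * (b - a) $ l = 0"
      unfolding block_scalar_prod_def by (subst (asm) sum_nonneg_eq_0_iff) auto
    then have "b $ k = a $ k" using k a b by auto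
    then show ?thesis using True k a b by (simp add: block_reflection_mult_vec del: index_mult_mat_vec)
  next
    case False
    then show ?thesis using N k a b
      by (simp add: block_reflection_mult_vec field_simps del: index_mult_mat_vec)
  qed
qed (use a b in auto)

lemma block_reflection_fix:
  assumes "dim_vec u = dim_vec w" and "\<And>x. block_scalar_prod d x w u = 0"
  shows "block_reflection d w *\<^sub>v u = u"
  by (rule eq_vecI) (use assms in \<open>auto simp: block_reflection_mult_vec simp del: index_mult_mat_vec\<close>)

lemma block_scalar_prod_reflection_invariant:
  assumes dim: "dim_vec u = dim_vec w" "dim_vec v = dim_vec w"
  shows "block_scalar_prod d x (block_reflection d w *\<^sub>v u) (block_reflection d w *\<^sub>v v) =
    block_scalar_prod d x u v"
proof -
  let ?p = "block_scalar_prod d x" and ?R = "block_reflection d w"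
  define N p q where "N = ?p w w" and "p = ?p w u" and "q = ?p w v"
  have "?p (?R *\<^sub>v u) (?R *\<^sub>v v) = (\<Sum>l | l < dim_vec w \<and> d l = x. (u $ l * v $ l
      - 2 * q / N * (w $ l * u $ l)) - (2 * p / N * (w $ l * v $ l) - 4 * p * q / (N * N) * (w $ l * w $ l)))"
    unfolding block_scalar_prod_def [of d x "_ *\<^sub>v _"]
    by (rule sum.cong) (auto simp: block_reflection_mult_vec dim algebra_simps N_def p_def q_def
        simp del: index_mult_mat_vec)
  also have "\<dots> = (?p u v - 2 * q / N * ?p w u) - (2 * p / N * ?p w v - 4 * p * q / (N * N) * ?p w w)"
    unfolding sum_subtractf sum_distrib_left [symmetric] by (simp add: block_scalar_prod_def dim)
  \<comment> \<open>The three correction terms cancel; for \<open>N = 0\<close> each of them is 0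
    because of \<open>x / 0 = 0\<close>.\<close>
  also have "\<dots> = ?p u v"
    by (simp flip: N_def p_def q_def)
  finally show ?thesis .
qed

text \<open>The two-vector case of Witt's theorem, in all eigenspaces at once. \<open>R\<close>
  carries \<open>a'\<close> to \<open>a\<close> and \<open>b'\<close> to some \<open>c\<close>.
  Since \<open>R\<close> preserves block products, \<open>c - b\<close> is orthogonal to
  \<open>a\<close> in every block, so the reflection \<open>S\<close> taking \<open>c\<close> to
  \<open>b\<close> leaves \<open>a\<close> in place.\<close>

lemma orthogonal_matching_commuting_with_diagonal:
  assumes [simp]: "a \<in> carrier_vec m" "b \<in> carrier_vec m" "a' \<in> carrier_vec m" "b' \<in> carrier_vec m"
    and aa: "\<And>x. block_scalar_prod d x a a = block_scalar_prod d x a' a'"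
    and ab: "\<And>x. block_scalar_prod d x a b = block_scalar_prod d x a' b'"
    and bb: "\<And>x. block_scalar_prod d x b b = block_scalar_prod d x b' b'"
  obtains Z where "Z \<in> carrier_mat m m" "Z\<^sup>T * Z = 1\<^sub>m m"
    "Z * diagonal m d = diagonal m d * Z" "Z *\<^sub>v a' = a" "Z *\<^sub>v b' = b"
proof -
  define R where "R = block_reflection d (a' - a)"
  define c where "c = R *\<^sub>v b'"
  define S where "S = block_reflection d (c - b)"
  have [simp]: "R \<in> carrier_mat m m" by (simp add: R_def)
  have [simp]: "c \<in> carrier_vec m" unfolding c_def by (rule mult_mat_vec_carrier [of _ m m]) auto
  have [simp]: "S \<in> carrier_mat m m" by (simp add: S_def)
  have dims: "dim_vec a = m" "dim_vec b = m" "dim_vec c = m" "dim_vec a' = m" "dim_vec b' = m"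
    using carrier_vecD by auto
  have Ra: "R *\<^sub>v a' = a" unfolding R_def by (rule block_reflection_swap [of _ m]) (use aa in auto)
  have cc: "block_scalar_prod d x c c = block_scalar_prod d x b b" for x
    unfolding c_def R_def bb by (rule block_scalar_prod_reflection_invariant) (auto simp: dims)
  have ac: "block_scalar_prod d x a c = block_scalar_prod d x a b" for x
  proof -
    have "block_scalar_prod d x (R *\<^sub>v a') (R *\<^sub>v b') = block_scalar_prod d x a' b'"
      unfolding R_def by (rule block_scalar_prod_reflection_invariant) (auto simp: dims)
    then show ?thesis by (simp add: Ra ab c_def)
  qed
  have Sc: "S *\<^sub>v c = b" unfolding S_def by (rule block_reflection_swap [of _ m]) (use cc in auto)
  have "block_scalar_prod d x (c - b) a = 0" for x
    using ac [of x] by (subst block_scalar_prod_commute)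
      (simp_all add: block_scalar_prod_diff_right dims)
  then have Sa: "S *\<^sub>v a = a"
    unfolding S_def by (intro block_reflection_fix) (auto simp: dims)
  have RT: "R\<^sup>T = R" and ST: "S\<^sup>T = S" by (simp_all add: R_def S_def)
  have RR: "R * R = 1\<^sub>m m" and SS: "S * S = 1\<^sub>m m"
    unfolding R_def S_def by (auto intro: block_reflection_involution)
  note assoc = assoc_mult_mat [of _ m m _ m _ m]
  have [simp]: "S * R \<in> carrier_mat m m" by (rule mult_carrier_mat [of _ m m]) auto
  have "(S * R)\<^sup>T * (S * R) = R * (S * (S * R))"
    by (simp add: transpose_mult [of _ m m _ m] RT ST assoc)
  also have "\<dots> = 1\<^sub>m m" by (simp flip: assoc add: SS) (simp add: RR right_mult_one_mat [of _ m m])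
  finally have orth: "(S * R)\<^sup>T * (S * R) = 1\<^sub>m m" .
  have "S * R * diagonal m d = S * (R * diagonal m d)" by (simp add: assoc)
  also have "\<dots> = S * diagonal m d * R"
    unfolding R_def by (subst block_reflection_commute [of _ m]) (auto simp: assoc simp flip: R_def)
  also have "\<dots> = diagonal m d * (S * R)"
    unfolding S_def by (subst block_reflection_commute [of _ m]) (auto simp: assoc simp flip: S_def)
  finally have comm: "S * R * diagonal m d = diagonal m d * (S * R)" .
  show ?thesis
    by (rule that [of "S * R"]) (auto simp: orth comm Ra Sa Sc assoc_mult_mat_vec [of _ m m _ m] simp flip: c_def)
qed

section \<open>Orthogonal diagonalization of real symmetric matrices\<close>

text \<open>Moving the matrix across the Hermitian product of an eigenvector \<open>v\<close> with
  itself turns the factor \<open>a\<close> into \<open>cnj a\<close>, and this product is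
  nonzero.\<close>

lemma symmetric_mat_eigenvalue_real:
  fixes A :: "real mat"
  assumes A: "A \<in> carrier_mat n n" and sym: "A\<^sup>T = A"
    and ev: "eigenvalue (map_mat complex_of_real A) a"
  shows "complex_of_real (Re a) = a"
proof -
  let ?A = "map_mat complex_of_real A"
  have cA: "?A \<in> carrier_mat n n" using A by simp
  have symc: "?A\<^sup>T = ?A" using sym by (metis map_mat_transpose)
  obtain v where v: "v \<in> carrier_vec n" "v \<noteq> 0\<^sub>v n" and Av: "?A *\<^sub>v v = a \<cdot>\<^sub>v v"
    using ev A unfolding eigenvalue_def eigenvector_def by auto
  have conj_Av: "conjugate (?A *\<^sub>v v) = ?A *\<^sub>v conjugate v"
    by (rule eq_vecI) (use A v in \<open>auto simp: scalar_prod_def sum_conjugate conjugate_dist_mul\<close>)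
  have "a * (v \<bullet>c v) = (?A\<^sup>T *\<^sub>v v) \<bullet> conjugate v"
    unfolding symc Av using v by simp
  also have "\<dots> = v \<bullet> (?A *\<^sub>v conjugate v)"
    by (rule transpose_vec_mult_scalar) (use A v in auto)
  also have "\<dots> = cnj a * (v \<bullet>c v)"
    unfolding conj_Av [symmetric] Av conjugate_smult_vec using v by simp
  finally have "a = cnj a" using v by simp
  then show ?thesis by (simp add: complex_eq_iff)
qed

text \<open>The factorization over the complex numbers has only real roots, so it pulls back along
  the injective embedding of real polynomials.\<close>

lemma char_poly_symmetric_mat_splits:
  fixes A :: "real mat"
  assumes A: "A \<in> carrier_mat n n" and sym: "A\<^sup>T = A"
  obtains es where "char_poly A = (\<Prod>e\<leftarrow>es. [:-e, 1:])"
proof -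
  let ?A = "map_mat complex_of_real A"
  have cA: "?A \<in> carrier_mat n n" using A by simp
  obtain as where as: "char_poly ?A = (\<Prod>a\<leftarrow>as. [:-a, 1:])"
    using char_poly_factorized [OF cA] by blast
  have "map (complex_of_real \<circ> Re) as = as"
  proof (rule map_idI)
    fix a assume "a \<in> set as"
    then have "poly (char_poly ?A) a = 0"
      unfolding as by (auto simp: poly_prod_list prod_list_zero_iff)
    then show "(complex_of_real \<circ> Re) a = a"
      using symmetric_mat_eigenvalue_real [OF A sym] eigenvalue_root_char_poly [OF cA] by simp
  qed
  then have as': "map complex_of_real (map Re as) = as" by simp
  interpret h: map_poly_inj_idom_hom complex_of_real ..
  have "map_poly complex_of_real (\<Prod>e\<leftarrow>es. [:-e, 1:]) =
      (\<Prod>a\<leftarrow>map complex_of_real es. [:-a, 1:])" for es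
    by (induction es) (simp_all add: h.hom_mult map_poly_pCons del: mult_pCons_left)
  from this [of "map Re as"]
  have "map_poly complex_of_real (\<Prod>e\<leftarrow>map Re as. [:-e, 1:]) = map_poly complex_of_real (char_poly A)"
    unfolding as' by (simp add: as flip: of_real_hom.char_poly_hom [OF A])
  then show ?thesis
    by (intro that [of "map Re as"]) (simp only: h.eq_iff)
qed

text \<open>A Householder reflection exchanging the first unit vector with a unit eigenvector makes
  the first column \<open>e\<close> times the first unit vector; symmetry then clears the first row
  as well.\<close>

lemma symmetric_mat_eigenvector_deflation:
  fixes A :: "real mat"
  assumes A: "A \<in> carrier_mat (Suc k) (Suc k)" and sym: "A\<^sup>T = A"
    and ev: "eigenvalue A e"
  obtains R A' where "R \<in> carrier_mat (Suc k) (Suc k)" "R\<^sup>T = R" "R * R = 1\<^sub>m (Suc k)"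
    "A' \<in> carrier_mat k k" "A'\<^sup>T = A'"
    "R * A * R = four_block_mat (e \<cdot>\<^sub>m 1\<^sub>m 1) (0\<^sub>m 1 k) (0\<^sub>m k 1) A'"
proof -
  let ?n = "Suc k" and ?e = "unit_vec (Suc k) 0 :: real vec"
  obtain v where v: "v \<in> carrier_vec ?n" "v \<noteq> 0\<^sub>v ?n" and Av: "A *\<^sub>v v = e \<cdot>\<^sub>v v"
    using ev A unfolding eigenvalue_def eigenvector_def by auto
  have "v \<bullet> v > 0" using conjugate_square_greater_0_vec [OF v(1)] v(2) by simp
  define u where "u = (1 / sqrt (v \<bullet> v)) \<cdot>\<^sub>v v"
  have u: "u \<in> carrier_vec ?n" using v by (simp add: u_def)
  have uu: "u \<bullet> u = 1" using \<open>v \<bullet> v > 0\<close> v by (simp add: u_def)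
  have Au: "A *\<^sub>v u = e \<cdot>\<^sub>v u"
    using A v by (simp add: u_def mult_mat_vec Av smult_smult_assoc mult.commute)
  \<comment> \<open>A constant function in place of \<open>d\<close> gives a single block, so this
    is an ordinary Householder reflection of the whole space.\<close>
  define R where "R = block_reflection (\<lambda>_. 0) (?e - u)"
  have R: "R \<in> carrier_mat ?n ?n" and RT: "R\<^sup>T = R" and RR: "R * R = 1\<^sub>m ?n"
    unfolding R_def using u by (auto intro!: block_reflection_involution)
  have bsp: "block_scalar_prod (\<lambda>_. 0) x w w = (if x = 0 then w \<bullet> w else 0)" for x and w :: "real vec"
    by (auto simp: block_scalar_prod_def scalar_prod_def atLeast0LessThan lessThan_def)
  have Re: "R *\<^sub>v ?e = u"
    unfolding R_def by (rule block_reflection_swap [of _ ?n]) (use u uu in \<open>auto simp: bsp\<close>)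
  have Ru: "R *\<^sub>v u = ?e"
    using R u unfolding Re [symmetric] by (simp add: RR flip: assoc_mult_mat_vec)
  define M where "M = R * A * R"
  have M: "M \<in> carrier_mat ?n ?n" using R A by (simp add: M_def)
  have MT: "M\<^sup>T = M"
    using R A by (simp add: M_def transpose_mult [of _ ?n ?n _ ?n] RT sym
        assoc_mult_mat [of _ ?n ?n _ ?n _ ?n])
  have "M *\<^sub>v ?e = R *\<^sub>v (A *\<^sub>v (R *\<^sub>v ?e))"
    using R A by (simp add: M_def assoc_mult_mat_vec [of _ ?n ?n _ ?n])
  also have "\<dots> = e \<cdot>\<^sub>v ?e"
    using R u by (simp add: Re Au mult_mat_vec Ru)
  finally have Me: "M *\<^sub>v ?e = e \<cdot>\<^sub>v ?e" .
  have M0: "M $$ (i, 0) = (if i = 0 then e else 0)" if "i < ?n" for i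
    using arg_cong [OF Me, of "\<lambda>w. w $ i"] that M by auto
  have M0': "M $$ (0, i) = (if i = 0 then e else 0)" if "i < ?n" for i
    using M0 [OF that] M that arg_cong [OF MT, of "\<lambda>N. N $$ (0, i)"] by simp
  define A' where "A' = mat k k (\<lambda>(i, j). M $$ (Suc i, Suc j))"
  have M_eq: "M = four_block_mat (e \<cdot>\<^sub>m 1\<^sub>m 1) (0\<^sub>m 1 k) (0\<^sub>m k 1) A'"
    by (rule eq_matI) (use M in \<open>auto simp: A'_def M0 M0'\<close>)
  have A'T: "A'\<^sup>T = A'"
  proof (rule eq_matI)
    fix i j assume "i < dim_row A'" "j < dim_col A'"
    then show "A'\<^sup>T $$ (i, j) = A' $$ (i, j)"
      using M arg_cong [OF MT, of "\<lambda>N. N $$ (Suc i, Suc j)"] by (simp add: A'_def)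
  qed (simp_all add: A'_def)
  have "A' \<in> carrier_mat k k" by (simp add: A'_def)
  then show ?thesis
    by (rule that [OF R RT RR _ A'T M_eq [unfolded M_def]])
qed

lemma char_poly_orthogonal_similar:
  fixes A :: "'a :: comm_ring_1 mat"
  assumes "A \<in> carrier_mat n n" "X \<in> carrier_mat n n" "X\<^sup>T * X = 1\<^sub>m n" "X * X\<^sup>T = 1\<^sub>m n"
  shows "char_poly (X\<^sup>T * A * X) = char_poly A"
  by (rule char_poly_similar, rule similar_matI [of _ _ "X\<^sup>T" X n]) (use assms in auto)

lemma mult_block_diagonal_mat:
  fixes A :: "'a :: comm_ring_1 mat"
  assumes "A \<in> carrier_mat k k" "B \<in> carrier_mat l l" "C \<in> carrier_mat k k" "D \<in> carrier_mat l l"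
  shows "four_block_mat A (0\<^sub>m k l) (0\<^sub>m l k) B * four_block_mat C (0\<^sub>m k l) (0\<^sub>m l k) D =
    four_block_mat (A * C) (0\<^sub>m k l) (0\<^sub>m l k) (B * D)"
  using assms by (subst mult_four_block_mat [of _ k k _ l _ l _ _ k _ l]) auto

text \<open>The list \<open>es\<close> is prescribed, order included, so that two matrices with the
  same characteristic polynomial can be brought to the same diagonal matrix. The induction deflates
  one eigenvalue at a time.\<close>

lemma symmetric_mat_orthogonal_diagonalization:
  fixes A :: "real mat"
  assumes "A \<in> carrier_mat n n" "A\<^sup>T = A" "char_poly A = (\<Prod>e\<leftarrow>es. [:-e, 1:])"
  shows "\<exists>X \<in> carrier_mat n n. X\<^sup>T * X = 1\<^sub>m n \<and> X\<^sup>T * A * X = diagonal n ((!) es)"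
  using assms
proof (induction es arbitrary: n A)
  case Nil
  then have "n = 0" using degree_monic_char_poly [of A n] by simp
  then show ?case
    using Nil by (intro bexI [of _ "1\<^sub>m 0"]) (auto intro!: eq_matI simp: diagonal_def)
next
  case (Cons e es)
  have "degree (char_poly A) = Suc (length es)"
    unfolding Cons.prems using degree_linear_factors [of uminus "e # es"] by simp
  then obtain k where n: "n = Suc k" using degree_monic_char_poly [OF Cons.prems(1)] by auto
  have "eigenvalue A e"
    unfolding eigenvalue_root_char_poly [OF Cons.prems(1)] Cons.prems(3) by simp
  then obtain R A' where R: "R \<in> carrier_mat n n" "R\<^sup>T = R" "R * R = 1\<^sub>m n"
    and A': "A' \<in> carrier_mat k k" "A'\<^sup>T = A'"
    and block: "R * A * R = four_block_mat (e \<cdot>\<^sub>m 1\<^sub>m 1) (0\<^sub>m 1 k) (0\<^sub>m k 1) A'"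
    using symmetric_mat_eigenvector_deflation [of A k e] Cons.prems unfolding n by metis
  \<comment> \<open>Deflation splits off exactly the linear factor of \<open>e\<close>; cancelling
    it gives the smaller block a factorization over the tail of the list, as the induction
    hypothesis requires.\<close>
  have "[:-e, 1:] * char_poly A' = char_poly (R * A * R)"
    unfolding block using A' by (subst char_poly_four_block_zeros_col)
      (auto simp: char_poly_defs det_single)
  also have "\<dots> = [:-e, 1:] * (\<Prod>e\<leftarrow>es. [:-e, 1:])"
    using char_poly_orthogonal_similar [of A n R] R Cons.prems by simp
  finally have "char_poly A' = (\<Prod>e\<leftarrow>es. [:-e, 1:])" by (metis mult_cancel_left pCons_eq_0_iff one_neq_zero)
  from Cons.IH [OF A' this] obtain X where X: "X \<in> carrier_mat k k" "X\<^sup>T * X = 1\<^sub>m k"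
    and diag: "X\<^sup>T * A' * X = diagonal k ((!) es)" by blast
  define E where "E = four_block_mat (1\<^sub>m 1) (0\<^sub>m 1 k) (0\<^sub>m k 1) X"
  have E: "E \<in> carrier_mat n n"
    unfolding E_def n using four_block_carrier_mat [of "1\<^sub>m 1" 1 1 X k k] X by simp
  have ET: "E\<^sup>T = four_block_mat (1\<^sub>m 1) (0\<^sub>m 1 k) (0\<^sub>m k 1) X\<^sup>T"
    unfolding E_def using X by (subst transpose_four_block_mat) auto
  have EE: "E\<^sup>T * E = 1\<^sub>m n"
    unfolding ET unfolding E_def n using X
    by (simp add: mult_block_diagonal_mat del: One_nat_def) simp
  have "E\<^sup>T * (R * A * R) * E =
      four_block_mat (e \<cdot>\<^sub>m 1\<^sub>m 1) (0\<^sub>m 1 k) (0\<^sub>m k 1) (X\<^sup>T * A' * X)"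
    unfolding ET block unfolding E_def using X A'
    by (simp add: mult_block_diagonal_mat del: One_nat_def)
  also have "\<dots> = diagonal n ((!) (e # es))"
    unfolding diag by (rule eq_matI) (auto simp: diagonal_def n nth_Cons split: nat.splits)
  finally have D: "E\<^sup>T * (R * A * R) * E = diagonal n ((!) (e # es))" .
  note assoc = assoc_mult_mat [of _ n n _ n _ n]
  have "(R * E)\<^sup>T * (R * E) = E\<^sup>T * (R * R) * E"
    using R(1,2) E by (simp add: transpose_mult [of _ n n _ n] assoc)
  moreover have "(R * E)\<^sup>T * A * (R * E) = E\<^sup>T * (R * A * R) * E"
    using R(1,2) E Cons.prems(1) by (simp add: transpose_mult [of _ n n _ n] assoc)
  ultimately show ?case
    using R E EE D by (intro bexI [of _ "R * E"]) auto
qed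

section \<open>Determinants of bordered matrices\<close>

lemma add_minus_cancel_mat:
  fixes M :: "'a :: ab_group_add mat"
  assumes "M \<in> carrier_mat nr nc" "N \<in> carrier_mat nr nc"
  shows "M + (N - M) = N" "N - M + M = N"
  using assms by (auto intro!: eq_matI)

lemma dim_diagonal [simp]: "dim_row (diagonal m d) = m" "dim_col (diagonal m d) = m"
  by (simp_all add: diagonal_def)

lemma diagonal_mult_vec:
  assumes "v \<in> carrier_vec m" "i < m"
  shows "(diagonal m d *\<^sub>v v) $ i = d i * v $ i"
  using assms by (simp add: diagonal_def scalar_prod_def if_distrib [of "\<lambda>x. x * _"] cong: if_cong)

text \<open>Block elimination: the matrix is a lower triangular factor with diagonal blocks
  \<open>S\<close> and the identity, times an upper triangular factor with the identity and the
  Schur complement.\<close>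

lemma det_four_block_schur_complement:
  fixes S :: "'a :: idom mat"
  assumes S: "S \<in> carrier_mat m m" and S': "S' \<in> carrier_mat m m" and inv: "S * S' = 1\<^sub>m m"
    and U: "U \<in> carrier_mat m k" and V: "V \<in> carrier_mat k m" and C: "C \<in> carrier_mat k k"
  shows "det (four_block_mat S U V C) = det S * det (C - V * S' * U)"
proof -
  have W: "V * (S' * U) \<in> carrier_mat k k" and SU: "S' * U \<in> carrier_mat m k"
    using U V S' by (auto intro!: mult_carrier_mat)
  have "S * (S' * U) = U"
    using assoc_mult_mat [OF S S' U] U by (simp add: inv)
  then have SSU: "S * (S' * U) + 0\<^sub>m m k * (C - V * (S' * U)) = U"
    using U W by (simp add: left_mult_zero_mat [of _ k k] minus_carrier_mat)
  have VC: "V * (S' * U) + 1\<^sub>m k * (C - V * (S' * U)) = C"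
    using add_minus_cancel_mat(1) [OF W C] left_mult_one_mat [OF minus_carrier_mat [OF W]] by simp
  have "four_block_mat S (0\<^sub>m m k) V (1\<^sub>m k) *
      four_block_mat (1\<^sub>m m) (S' * U) (0\<^sub>m k m) (C - V * (S' * U)) = four_block_mat S U V C"
    unfolding mult_four_block_mat [OF S zero_carrier_mat V one_carrier_mat one_carrier_mat SU
        zero_carrier_mat minus_carrier_mat [OF W]] SSU VC
    using S V by (simp add: right_mult_one_mat [of _ m m] right_mult_one_mat [of _ k m])
  then have "four_block_mat S U V C =
      four_block_mat S (0\<^sub>m m k) V (1\<^sub>m k) *
      four_block_mat (1\<^sub>m m) (S' * U) (0\<^sub>m k m) (C - V * (S' * U))" by simp
  also have "det \<dots> = det (four_block_mat S (0\<^sub>m m k) V (1\<^sub>m k)) *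
      det (four_block_mat (1\<^sub>m m) (S' * U) (0\<^sub>m k m) (C - V * (S' * U)))"
    by (rule det_mult [OF four_block_carrier_mat [OF S one_carrier_mat]
          four_block_carrier_mat [OF one_carrier_mat minus_carrier_mat [OF W]]])
  also have "\<dots> = det S * det (C - V * (S' * U))"
    using det_four_block_mat_upper_right_zero [OF S refl V one_carrier_mat]
      det_four_block_mat_lower_left_zero [OF one_carrier_mat SU refl minus_carrier_mat [OF W]] by simp
  finally show ?thesis
    using assoc_mult_mat [OF V S' U] by simp
qed

text \<open>The same elimination, performed on the identity corner. It turns a subtracted product
  into a border, so that the all-ones matrix can be handled as one more border vector.\<close>

lemma det_minus_outer_product:
  fixes M :: "'a :: idom mat"
  assumes M: "M \<in> carrier_mat m m" and U: "U \<in> carrier_mat m k" and V: "V \<in> carrier_mat k m"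
  shows "det (M - U * V) = det (four_block_mat M U V (1\<^sub>m k))"
proof -
  have UV: "U * V \<in> carrier_mat m m" using U V by simp
  have MUV: "M - U * V \<in> carrier_mat m m" using UV by (rule minus_carrier_mat)
  have "M - U * V + U * V = M"
    by (rule add_minus_cancel_mat [OF UV M])
  then have "four_block_mat M U V (1\<^sub>m k) =
      four_block_mat (M - U * V) U (0\<^sub>m k m) (1\<^sub>m k) * four_block_mat (1\<^sub>m m) (0\<^sub>m m k) V (1\<^sub>m k)"
    using M U V UV by (subst mult_four_block_mat [of _ m m _ k _ k _ _ m _ k])
      (auto simp: right_mult_one_mat [of _ m m])
  also have "det \<dots> = det (four_block_mat (M - U * V) U (0\<^sub>m k m) (1\<^sub>m k)) *
      det (four_block_mat (1\<^sub>m m) (0\<^sub>m m k) V (1\<^sub>m k))"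
    by (rule det_mult [of _ "m + k"]) (use M MUV in \<open>auto intro!: four_block_carrier_mat\<close>)
  also have "\<dots> = det (M - U * V)"
    using det_four_block_mat_lower_left_zero [OF MUV U refl one_carrier_mat]
      det_four_block_mat_upper_right_zero [OF one_carrier_mat refl V one_carrier_mat] by simp
  finally show ?thesis by simp
qed

lemma det_mat_2:
  fixes f :: "nat \<times> nat \<Rightarrow> 'a :: idom"
  shows "det (mat 2 2 f) = f (0, 0) * f (1, 1) - f (0, 1) * f (1, 0)"
proof -
  let ?c = "\<lambda>x. mat 1 1 (\<lambda>_. x) :: 'a mat"
  have mult: "?c x * ?c y = ?c (x * y)" for x y
    by (rule eq_matI) (simp_all add: scalar_prod_def)
  have minus: "?c x - ?c y = ?c (x - y)" for x y
    by (rule eq_matI) simp_all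
  have det: "det (?c x) = x" for x
    by (simp only: det_single [OF mat_carrier]) simp
  have *: "mat 2 2 f = four_block_mat (?c (f (0, 0))) (?c (f (0, 1))) (?c (f (1, 0))) (?c (f (1, 1)))"
  proof (rule eq_matI, goal_cases)
    case (1 i j)
    then have "i < 2" "j < 2" by simp_all
    then show ?case by (auto simp: less_2_cases_iff)
  qed simp_all
  have "det (mat 2 2 f) = det (?c (f (0, 0)) * ?c (f (1, 1)) - ?c (f (0, 1)) * ?c (f (1, 0)))"
    unfolding * by (rule det_four_block_mat [of _ 1]) (simp_all only: mult mult.commute mat_carrier)
  then show ?thesis by (simp only: mult minus det)
qed

section \<open>Resolvents of an orthogonally diagonalized matrix\<close>

lemma diagonal_mult:
  "diagonal m d * diagonal m e = diagonal m (\<lambda>i. d i * e i)"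
  by (rule eq_matI) (auto simp: diagonal_def scalar_prod_def if_distrib [of "\<lambda>x. x * _"] cong: if_cong)

text \<open>The bilinear form of the inverse of \<open>s + A\<close> in eigencoordinates, see
  \<open>quadratic_form_inverse\<close>. With this sign of the shift, poles can lie only at the
  values \<open>- d i\<close>.\<close>

definition resolvent_form :: "(nat \<Rightarrow> real) \<Rightarrow> real \<Rightarrow> real vec \<Rightarrow> real vec \<Rightarrow> real" where
  "resolvent_form d s u w = (\<Sum>i<dim_vec w. u $ i * w $ i / (s + d i))"

locale orthogonal_diagonalization =
  fixes m :: nat and A X :: "real mat" and d :: "nat \<Rightarrow> real"
  assumes A: "A \<in> carrier_mat m m" and X: "X \<in> carrier_mat m m"
    and orth: "X\<^sup>T * X = 1\<^sub>m m" and diag: "X\<^sup>T * A * X = diagonal m d"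
begin

lemma orth': "X * X\<^sup>T = 1\<^sub>m m"
  by (rule mat_mult_left_right_inverse [of _ m]) (use X orth in auto)

lemma A_eq: "A = X * diagonal m d * X\<^sup>T"
proof -
  have "X * (X\<^sup>T * A * X) * X\<^sup>T = (X * X\<^sup>T) * A * (X * X\<^sup>T)"
    using A X by (simp add: assoc_mult_mat [of _ m m _ m _ m])
  then show ?thesis using A by (simp add: diag orth')
qed

lemma shift_eq: "s \<cdot>\<^sub>m 1\<^sub>m m + A = X * diagonal m (\<lambda>i. s + d i) * X\<^sup>T"
proof -
  have "diagonal m (\<lambda>i. s + d i) = s \<cdot>\<^sub>m 1\<^sub>m m + diagonal m d"
    by (rule eq_matI) (auto simp: diagonal_def)
  then have "X * diagonal m (\<lambda>i. s + d i) * X\<^sup>T = (X * (s \<cdot>\<^sub>m 1\<^sub>m m) + X * diagonal m d) * X\<^sup>T"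
    using X by (simp add: mult_add_distrib_mat [of _ m m _ m])
  also have "\<dots> = X * (s \<cdot>\<^sub>m 1\<^sub>m m) * X\<^sup>T + X * diagonal m d * X\<^sup>T"
    using X by (intro add_mult_distrib_mat [of _ m m _ _ m]) auto
  also have "X * (s \<cdot>\<^sub>m 1\<^sub>m m) * X\<^sup>T = s \<cdot>\<^sub>m (X * X\<^sup>T)"
    using X by (simp add: mult_smult_distrib [of _ m m _ m] mult_smult_assoc_mat [of _ m m _ m])
  finally show ?thesis by (simp add: orth' flip: A_eq)
qed

lemma shift_inverse:
  assumes "\<forall>i<m. s + d i \<noteq> 0"
  shows "(s \<cdot>\<^sub>m 1\<^sub>m m + A) * (X * diagonal m (\<lambda>i. 1 / (s + d i)) * X\<^sup>T) = 1\<^sub>m m"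
proof -
  have "diagonal m (\<lambda>i. s + d i) * diagonal m (\<lambda>i. 1 / (s + d i)) = 1\<^sub>m m"
    unfolding diagonal_mult by (rule eq_matI) (use assms in \<open>auto simp: diagonal_def\<close>)
  moreover have "X * diagonal m (\<lambda>i. s + d i) * X\<^sup>T * (X * diagonal m (\<lambda>i. 1 / (s + d i)) * X\<^sup>T) =
      X * (diagonal m (\<lambda>i. s + d i) * ((X\<^sup>T * X) * diagonal m (\<lambda>i. 1 / (s + d i)))) * X\<^sup>T"
    using X by (simp add: assoc_mult_mat [of _ m m _ m _ m] mult_carrier_mat [of _ m m])
  ultimately show ?thesis
    using X unfolding shift_eq orth
    by (simp add: orth' left_mult_one_mat [of _ m m] right_mult_one_mat [of _ m m])
qed

lemma det_shift_nonzero: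
  assumes "\<forall>i<m. s + d i \<noteq> 0"
  shows "det (s \<cdot>\<^sub>m 1\<^sub>m m + A) \<noteq> 0"
proof
  assume "det (s \<cdot>\<^sub>m 1\<^sub>m m + A) = 0"
  then have "det ((s \<cdot>\<^sub>m 1\<^sub>m m + A) * (X * diagonal m (\<lambda>i. 1 / (s + d i)) * X\<^sup>T)) = 0"
    using A X by (subst det_mult [of _ m]) (auto intro!: mult_carrier_mat [of _ m m])
  then show False using shift_inverse [OF assms] by simp
qed

lemma quadratic_form_inverse:
  assumes u: "u \<in> carrier_vec m" and w: "w \<in> carrier_vec m"
  shows "u \<bullet> ((X * diagonal m (\<lambda>i. 1 / (s + d i)) * X\<^sup>T) *\<^sub>v w) =
    resolvent_form d s (X\<^sup>T *\<^sub>v u) (X\<^sup>T *\<^sub>v w)"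
proof -
  let ?D = "diagonal m (\<lambda>i. 1 / (s + d i))" and ?w = "X\<^sup>T *\<^sub>v w"
  have Xw: "?w \<in> carrier_vec m" using X w by (simp add: mult_mat_vec_carrier [of _ m m])
  have D: "(?D *\<^sub>v ?w) $ i = ?w $ i / (s + d i)" if "i < m" for i
    using diagonal_mult_vec [OF Xw that] by simp
  have "u \<bullet> ((X * ?D * X\<^sup>T) *\<^sub>v w) = u \<bullet> (X *\<^sub>v (?D *\<^sub>v ?w))"
    using X w Xw by (simp add: assoc_mult_mat_vec [of _ m m _ m] mult_carrier_mat [of _ m m])
  also have "\<dots> = (X\<^sup>T *\<^sub>v u) \<bullet> (?D *\<^sub>v ?w)"
    by (rule transpose_vec_mult_scalar [symmetric, of _ m m])
      (use X u Xw in \<open>auto intro!: mult_mat_vec_carrier [of _ m m]\<close>)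
  also have "\<dots> = resolvent_form d s (X\<^sup>T *\<^sub>v u) ?w"
    using X unfolding scalar_prod_def resolvent_form_def
    by (intro sum.cong) (auto simp: D atLeast0LessThan simp del: index_mult_mat_vec)
  finally show ?thesis .
qed

text \<open>Rows and columns of the border are the same vectors, so the entries of the Schur
  complement are resolvent forms. This is applied to one border vector (the root's or the all-ones
  vector) and to both together.\<close>

lemma det_bordered:
  assumes us: "set us \<subseteq> carrier_vec m" and C: "C \<in> carrier_mat (length us) (length us)"
    and s: "\<forall>i<m. s + d i \<noteq> 0"
  shows "det (four_block_mat (s \<cdot>\<^sub>m 1\<^sub>m m + A) (mat_of_cols m us) (mat_of_rows m us) C) =
    det (s \<cdot>\<^sub>m 1\<^sub>m m + A) * det (mat (length us) (length us)
      (\<lambda>(i, j). C $$ (i, j) - resolvent_form d s (X\<^sup>T *\<^sub>v us ! i) (X\<^sup>T *\<^sub>v us ! j)))"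
proof -
  let ?S' = "X * diagonal m (\<lambda>i. 1 / (s + d i)) * X\<^sup>T"
  let ?k = "length us" and ?U = "mat_of_cols m us" and ?V = "mat_of_rows m us"
  have S': "?S' \<in> carrier_mat m m" using X by (auto intro!: mult_carrier_mat [of _ m m])
  have U: "?U \<in> carrier_mat m ?k" and V: "?V \<in> carrier_mat ?k m" by auto
  have "C - ?V * ?S' * ?U = mat ?k ?k
      (\<lambda>(i, j). C $$ (i, j) - resolvent_form d s (X\<^sup>T *\<^sub>v us ! i) (X\<^sup>T *\<^sub>v us ! j))"
  proof (rule eq_matI)
    fix i j assume "i < dim_row (mat ?k ?k
        (\<lambda>(i, j). C $$ (i, j) - resolvent_form d s (X\<^sup>T *\<^sub>v us ! i) (X\<^sup>T *\<^sub>v us ! j)))"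
      and "j < dim_col (mat ?k ?k
        (\<lambda>(i, j). C $$ (i, j) - resolvent_form d s (X\<^sup>T *\<^sub>v us ! i) (X\<^sup>T *\<^sub>v us ! j)))"
    then have ij: "i < ?k" "j < ?k" by auto
    then have c: "us ! i \<in> carrier_vec m" "us ! j \<in> carrier_vec m" using us nth_mem by blast+
    have "(?V * (?S' * ?U)) $$ (i, j) = row ?V i \<bullet> col (?S' * ?U) j"
      using ij S' by (intro index_mult_mat) auto
    also have "col (?S' * ?U) j = ?S' *\<^sub>v us ! j"
      using col_mult2 [OF S' U ij(2)] ij c by simp
    also have "row ?V i = us ! i" using ij c by simp
    finally have "(?V * ?S' * ?U) $$ (i, j) =
        resolvent_form d s (X\<^sup>T *\<^sub>v us ! i) (X\<^sup>T *\<^sub>v us ! j)"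
      using quadratic_form_inverse [OF c] assoc_mult_mat [OF V S' U] by simp
    then show "(C - ?V * ?S' * ?U) $$ (i, j) = mat ?k ?k
      (\<lambda>(i, j). C $$ (i, j) - resolvent_form d s (X\<^sup>T *\<^sub>v us ! i) (X\<^sup>T *\<^sub>v us ! j)) $$ (i, j)"
      using ij C by simp
  qed (use C in auto)
  with det_four_block_schur_complement [OF _ S' shift_inverse [OF s] U V C] A show ?thesis
    by simp
qed

end

definition all_ones_mat :: "nat \<Rightarrow> real mat" where
  "all_ones_mat n = mat n n (\<lambda>_. 1)"

lemma det_minus_all_ones_mat:
  assumes "M \<in> carrier_mat n n"
  shows "det (M - all_ones_mat n) =
    det (four_block_mat M (mat_of_cols n [vec n (\<lambda>_. 1)]) (mat_of_rows n [vec n (\<lambda>_. 1)]) (1\<^sub>m 1))"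
proof -
  have *: "all_ones_mat n = mat_of_cols n [vec n (\<lambda>_. 1)] * mat_of_rows n [vec n (\<lambda>_. 1)]"
    by (rule eq_matI) (auto simp: all_ones_mat_def scalar_prod_def mat_of_cols_def mat_of_rows_def)
  show ?thesis
    unfolding * by (rule det_minus_outer_product [OF assms]) auto
qed

text \<open>An adjacency matrix has this form when the root is listed last: \<open>b\<close> records
  the neighbours of the root, and the corner is 0 because there are no loops.\<close>

definition bordered_by_vec :: "real mat \<Rightarrow> real vec \<Rightarrow> real mat" where
  "bordered_by_vec A b =
     four_block_mat A (mat_of_cols (dim_vec b) [b]) (mat_of_rows (dim_vec b) [b]) (0\<^sub>m 1 1)"

context orthogonal_diagonalization
begin

abbreviation "ones \<equiv> vec m (\<lambda>_. 1 :: real)"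
abbreviation "K s u w \<equiv> resolvent_form d s (X\<^sup>T *\<^sub>v u) (X\<^sup>T *\<^sub>v w)"

lemma det_shift_minus_all_ones:
  assumes s: "\<forall>i<m. s + d i \<noteq> 0"
  shows "det (s \<cdot>\<^sub>m 1\<^sub>m m + A - all_ones_mat m) = det (s \<cdot>\<^sub>m 1\<^sub>m m + A) * (1 - K s ones ones)"
proof -
  have "s \<cdot>\<^sub>m 1\<^sub>m m + A \<in> carrier_mat m m" using A by simp
  then show ?thesis
    using det_bordered [of "[ones]" "1\<^sub>m 1" s, OF _ _ s]
    by (simp add: det_minus_all_ones_mat det_single)
qed

lemma det_shift_bordered:
  assumes b: "b \<in> carrier_vec m" and s: "\<forall>i<m. s + d i \<noteq> 0"
  shows "det (s \<cdot>\<^sub>m 1\<^sub>m (Suc m) + bordered_by_vec A b) = det (s \<cdot>\<^sub>m 1\<^sub>m m + A) * (s - K s b b)"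
proof -
  have "s \<cdot>\<^sub>m 1\<^sub>m (Suc m) + bordered_by_vec A b =
      four_block_mat (s \<cdot>\<^sub>m 1\<^sub>m m + A) (mat_of_cols m [b]) (mat_of_rows m [b]) (s \<cdot>\<^sub>m 1\<^sub>m 1)"
    by (rule eq_matI) (use A b in \<open>auto simp: bordered_by_vec_def mat_of_cols_def mat_of_rows_def\<close>)
  then show ?thesis using b s by (simp add: det_bordered det_single)
qed

text \<open>Trading the subtracted all-ones matrix for a border leaves two border vectors,
  \<open>b\<close> and \<open>ones\<close>, and a 2 by 2 Schur complement. Among the determinants
  computed here, this is the one that sees the mixed form of \<open>b\<close> and
  \<open>ones\<close>.\<close>

lemma det_shift_bordered_minus_all_ones:
  assumes b: "b \<in> carrier_vec m" and s: "\<forall>i<m. s + d i \<noteq> 0"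
  shows "det (s \<cdot>\<^sub>m 1\<^sub>m (Suc m) + bordered_by_vec A b - all_ones_mat (Suc m)) =
    det (s \<cdot>\<^sub>m 1\<^sub>m m + A) *
      ((s - K s b b) * (1 - K s ones ones) - (1 - K s b ones) * (1 - K s ones b))"
proof -
  \<comment> \<open>The entry \<open>s\<close> is the root's diagonal entry, the off-diagonal 1s are
    the last entries of the all-ones vector of length \<open>Suc m\<close>, and the remaining 1 is
    the corner of the new border.\<close>
  let ?C = "mat 2 2 (\<lambda>(i, j). if i = 0 \<and> j = 0 then s else 1)"
  have "four_block_mat (s \<cdot>\<^sub>m 1\<^sub>m (Suc m) + bordered_by_vec A b)
      (mat_of_cols (Suc m) [vec (Suc m) (\<lambda>_. 1)]) (mat_of_rows (Suc m) [vec (Suc m) (\<lambda>_. 1)]) (1\<^sub>m 1) =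
    four_block_mat (s \<cdot>\<^sub>m 1\<^sub>m m + A) (mat_of_cols m [b, ones]) (mat_of_rows m [b, ones]) ?C"
    by (rule eq_matI)
      (use A b in \<open>auto simp: bordered_by_vec_def mat_of_cols_def mat_of_rows_def less_Suc_eq nth_Cons'\<close>)
  moreover have "s \<cdot>\<^sub>m 1\<^sub>m (Suc m) + bordered_by_vec A b \<in> carrier_mat (Suc m) (Suc m)"
    using A b by (auto simp: bordered_by_vec_def)
  ultimately show ?thesis
    using det_bordered [of "[b, ones]" ?C s] b s
    by (simp only: det_minus_all_ones_mat) (simp add: det_mat_2 flip: numeral_2_eq_2)
qed

end

section \<open>Recovering the eigenspace data from the resolvent\<close>

text \<open>Values of \<open>d\<close> may repeat, so only the sums of coefficients over equal
  values are determined. Clearing denominators gives a polynomial that vanishes for all large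
  \<open>s\<close>, hence is 0; at \<open>-x\<close> only the term of \<open>x\<close>
  survives.\<close>

lemma partial_fractions_unique:
  fixes c d :: "nat \<Rightarrow> real"
  assumes ev: "eventually (\<lambda>s. (\<Sum>i<m. c i / (s + d i)) = 0) at_top"
  shows "(\<Sum>i | i < m \<and> d i = x. c i) = 0"
proof (cases "x \<in> d ` {..<m}")
  case False
  then have "{i. i < m \<and> d i = x} = {}" by auto
  then show ?thesis by (simp only: sum.empty)
next
  case True
  define S where "S = d ` {..<m}"
  define C where "C = (\<lambda>y. \<Sum>i | i < m \<and> d i = y. c i)"
  have fin: "finite S" by (simp add: S_def)
  \<comment> \<open>The partial fraction sum multiplied by the product of \<open>s + z\<close> over
    all distinct values \<open>z\<close>.\<close>
  define P where "P = (\<Sum>y\<in>S. Polynomial.smult (C y) (\<Prod>z\<in>S - {y}. [:z, 1:]))"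
  have group: "(\<Sum>i<m. c i / (s + d i)) = (\<Sum>y\<in>S. C y / (s + y))" for s
  proof -
    have "(\<Sum>i<m. c i / (s + d i)) = (\<Sum>y\<in>S. \<Sum>i | i \<in> {..<m} \<and> d i = y. c i / (s + d i))"
      unfolding S_def by (rule sum.image_gen) simp
    also have "\<dots> = (\<Sum>y\<in>S. C y / (s + y))"
      by (rule sum.cong) (auto simp: C_def sum_divide_distrib intro!: sum.cong)
    finally show ?thesis .
  qed
  have "eventually (\<lambda>s::real. \<forall>y\<in>S. s + y \<noteq> 0) at_top"
  proof (rule eventually_ball_finite [OF fin], rule ballI)
    fix y :: real show "eventually (\<lambda>s. s + y \<noteq> 0) at_top"
      using eventually_gt_at_top [of "-y"] by eventually_elim auto
  qed
  with ev have "eventually (\<lambda>s. poly P s = 0) at_top"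
  proof eventually_elim
    case (elim s)
    have "C y * (\<Prod>z\<in>S - {y}. s + z) = (\<Prod>z\<in>S. s + z) * (C y / (s + y))" if "y \<in> S" for y
      using that elim by (simp add: prod.remove [OF fin that])
    then have "poly P s = (\<Prod>z\<in>S. s + z) * (\<Sum>y\<in>S. C y / (s + y))"
      by (simp add: P_def poly_sum poly_prod sum_distrib_left add.commute)
    then show ?case using elim group by simp
  qed
  then obtain N where N: "\<And>s. s \<ge> N \<Longrightarrow> poly P s = 0"
    by (auto simp: eventually_at_top_linorder)
  have "P = 0"
  proof (rule ccontr)
    assume "P \<noteq> 0"
    then have "finite {s. poly P s = 0}" by (rule poly_roots_finite)
    then have "finite {N..}" by (rule finite_subset [rotated]) (use N in auto)
    then show False using infinite_Ici by blast
  qed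
  \<comment> \<open>For \<open>y\<close> other than \<open>x\<close> the product contains the factor
    for \<open>z = x\<close>, which vanishes at \<open>-x\<close>.\<close>
  have "poly P (-x) = (\<Sum>y\<in>S. if y = x then C x * (\<Prod>z\<in>S - {x}. z - x) else 0)"
    unfolding P_def poly_sum poly_smult poly_prod
  proof (rule sum.cong [OF refl])
    fix y assume "y \<in> S"
    show "C y * (\<Prod>z\<in>S - {y}. poly [:z, 1:] (- x)) = (if y = x then C x * (\<Prod>z\<in>S - {x}. z - x) else 0)"
      using True fin by (auto simp: S_def)
  qed
  also have "\<dots> = C x * (\<Prod>z\<in>S - {x}. z - x)"
    using True fin by (simp add: S_def)
  finally have "C x * (\<Prod>z\<in>S - {x}. z - x) = 0" using \<open>P = 0\<close> by simp
  then have "C x = 0" using fin by auto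
  then show ?thesis by (simp add: C_def)
qed

lemma resolvent_form_commute:
  "dim_vec u = dim_vec w \<Longrightarrow> resolvent_form d s u w = resolvent_form d s w u"
  by (simp add: resolvent_form_def mult.commute)

lemma resolvent_form_tendsto_0: "((\<lambda>s. resolvent_form d s u w) \<longlongrightarrow> 0) at_top"
  unfolding resolvent_form_def
proof (rule tendsto_null_sum)
  fix i
  have "filterlim (\<lambda>s. d i + s) at_top at_top"
    by (rule filterlim_tendsto_add_at_top [OF tendsto_const filterlim_ident])
  then have "filterlim (\<lambda>s. s + d i) at_infinity at_top"
    by (simp add: add.commute filterlim_at_top_imp_at_infinity)
  then show "((\<lambda>s. u $ i * w $ i / (s + d i)) \<longlongrightarrow> 0) at_top"
    by (rule tendsto_divide_0 [OF tendsto_const])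
qed

text \<open>The block product at \<open>x\<close> is the residue of the resolvent form at
  \<open>-x\<close>, and forms that agree for all large \<open>s\<close> have equal
  residues.\<close>

lemma block_scalar_prod_eqI:
  assumes dim: "dim_vec w = m" "dim_vec w' = m"
    and ev: "eventually (\<lambda>s. resolvent_form d s u w = resolvent_form d s u' w') at_top"
  shows "block_scalar_prod d x u w = block_scalar_prod d x u' w'"
proof -
  have "eventually (\<lambda>s. (\<Sum>i<m. (u $ i * w $ i - u' $ i * w' $ i) / (s + d i)) = 0) at_top"
    using ev by eventually_elim
      (simp add: resolvent_form_def dim diff_divide_distrib sum_subtractf)
  then have "(\<Sum>i | i < m \<and> d i = x. u $ i * w $ i - u' $ i * w' $ i) = 0"
    by (rule partial_fractions_unique)
  then show ?thesis by (simp add: block_scalar_prod_def dim sum_subtractf)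
qed

text \<open>
  The characteristic polynomials only determine \<^term>\<open>(1 - q)\<^sup>2\<close> for the mixed resolvent
  \<^term>\<open>q\<close>; since \<^term>\<open>q\<close> vanishes at infinity, the sign is determined as well.
\<close>
lemma resolvent_forms_eq:
  fixes A B :: "real mat"
  assumes dA: "orthogonal_diagonalization m A X d" and dB: "orthogonal_diagonalization m B Y d"
    and b: "b \<in> carrier_vec m" and c: "c \<in> carrier_vec m"
    and eq: "\<And>s. det (s \<cdot>\<^sub>m 1\<^sub>m m + A) = det (s \<cdot>\<^sub>m 1\<^sub>m m + B)"
    and eqJ: "\<And>s. det (s \<cdot>\<^sub>m 1\<^sub>m m + A - all_ones_mat m) =
      det (s \<cdot>\<^sub>m 1\<^sub>m m + B - all_ones_mat m)"
    and beq: "\<And>s. det (s \<cdot>\<^sub>m 1\<^sub>m (Suc m) + bordered_by_vec A b) =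
      det (s \<cdot>\<^sub>m 1\<^sub>m (Suc m) + bordered_by_vec B c)"
    and beqJ: "\<And>s. det (s \<cdot>\<^sub>m 1\<^sub>m (Suc m) + bordered_by_vec A b - all_ones_mat (Suc m)) =
      det (s \<cdot>\<^sub>m 1\<^sub>m (Suc m) + bordered_by_vec B c - all_ones_mat (Suc m))"
  defines "e \<equiv> vec m (\<lambda>_. 1 :: real)"
  shows "eventually (\<lambda>s.
    resolvent_form d s (X\<^sup>T *\<^sub>v e) (X\<^sup>T *\<^sub>v e) = resolvent_form d s (Y\<^sup>T *\<^sub>v e) (Y\<^sup>T *\<^sub>v e) \<and>
    resolvent_form d s (X\<^sup>T *\<^sub>v b) (X\<^sup>T *\<^sub>v b) = resolvent_form d s (Y\<^sup>T *\<^sub>v c) (Y\<^sup>T *\<^sub>v c) \<and>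
    resolvent_form d s (X\<^sup>T *\<^sub>v e) (X\<^sup>T *\<^sub>v b) = resolvent_form d s (Y\<^sup>T *\<^sub>v e) (Y\<^sup>T *\<^sub>v c)) at_top"
proof -
  interpret A: orthogonal_diagonalization m A X d by (fact dA)
  interpret B: orthogonal_diagonalization m B Y d by (fact dB)
  have "eventually (\<lambda>s. \<forall>i\<in>{..<m}. s + d i \<noteq> 0) at_top"
  proof (rule eventually_ball_finite, simp, rule ballI)
    fix i show "eventually (\<lambda>s. s + d i \<noteq> 0) at_top"
      using eventually_gt_at_top [of "- d i"] by eventually_elim auto
  qed
  moreover have "eventually (\<lambda>s. resolvent_form d s (X\<^sup>T *\<^sub>v e) (X\<^sup>T *\<^sub>v b) < 1) at_top"
    using resolvent_form_tendsto_0 by (rule order_tendstoD) simp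
  moreover have "eventually (\<lambda>s. resolvent_form d s (Y\<^sup>T *\<^sub>v e) (Y\<^sup>T *\<^sub>v c) < 1) at_top"
    using resolvent_form_tendsto_0 by (rule order_tendstoD) simp
  ultimately show ?thesis
  proof eventually_elim
    case (elim s)
    then have s: "\<forall>i<m. s + d i \<noteq> 0" by auto
    let ?D = "det (s \<cdot>\<^sub>m 1\<^sub>m m + B)"
    let ?q = "resolvent_form d s (X\<^sup>T *\<^sub>v e) (X\<^sup>T *\<^sub>v b)"
    let ?q' = "resolvent_form d s (Y\<^sup>T *\<^sub>v e) (Y\<^sup>T *\<^sub>v c)"
    have D: "?D \<noteq> 0" by (rule B.det_shift_nonzero [OF s])
    have p: "resolvent_form d s (X\<^sup>T *\<^sub>v e) (X\<^sup>T *\<^sub>v e) = resolvent_form d s (Y\<^sup>T *\<^sub>v e) (Y\<^sup>T *\<^sub>v e)"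
      using eqJ [of s] D unfolding A.det_shift_minus_all_ones [OF s]
        B.det_shift_minus_all_ones [OF s] eq e_def by simp
    have r: "resolvent_form d s (X\<^sup>T *\<^sub>v b) (X\<^sup>T *\<^sub>v b) = resolvent_form d s (Y\<^sup>T *\<^sub>v c) (Y\<^sup>T *\<^sub>v c)"
      using beq [of s] D unfolding A.det_shift_bordered [OF b s]
        B.det_shift_bordered [OF c s] eq by simp
    have comm: "resolvent_form d s (X\<^sup>T *\<^sub>v b) (X\<^sup>T *\<^sub>v e) = ?q"
      "resolvent_form d s (Y\<^sup>T *\<^sub>v c) (Y\<^sup>T *\<^sub>v e) = ?q'"
      by (auto intro: resolvent_form_commute)
    \<comment> \<open>After \<open>p\<close> and \<open>r\<close>, the two sides of the fourth
      determinant identity can differ only in the product of the mixed factors, which is a square by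
      symmetry of the form.\<close>
    have "(1 - ?q) * (1 - ?q) = (1 - ?q') * (1 - ?q')"
      using beqJ [of s] D unfolding A.det_shift_bordered_minus_all_ones [OF b s]
        B.det_shift_bordered_minus_all_ones [OF c s] eq
      unfolding e_def [symmetric] p r comm by simp
    then have "1 - ?q = 1 - ?q'"
      using elim by (simp add: square_eq_iff)
    with p r show ?case by simp
  qed
qed

text \<open>In eigencoordinates of \<open>A\<close> and \<open>B\<close> the task is to match two
  pairs of vectors by an orthogonal matrix commuting with one diagonal matrix. Equal resolvent forms
  supply the equal block products this requires.\<close>

lemma orthogonal_similarity_of_bordered:
  fixes A B :: "real mat"
  assumes A: "A \<in> carrier_mat m m" "A\<^sup>T = A" and B: "B \<in> carrier_mat m m" "B\<^sup>T = B"
    and char_poly: "char_poly A = char_poly B"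
    and b: "b \<in> carrier_vec m" and c: "c \<in> carrier_vec m"
    and eq: "\<And>s. det (s \<cdot>\<^sub>m 1\<^sub>m m + A) = det (s \<cdot>\<^sub>m 1\<^sub>m m + B)"
    and eqJ: "\<And>s. det (s \<cdot>\<^sub>m 1\<^sub>m m + A - all_ones_mat m) =
      det (s \<cdot>\<^sub>m 1\<^sub>m m + B - all_ones_mat m)"
    and beq: "\<And>s. det (s \<cdot>\<^sub>m 1\<^sub>m (Suc m) + bordered_by_vec A b) =
      det (s \<cdot>\<^sub>m 1\<^sub>m (Suc m) + bordered_by_vec B c)"
    and beqJ: "\<And>s. det (s \<cdot>\<^sub>m 1\<^sub>m (Suc m) + bordered_by_vec A b - all_ones_mat (Suc m)) =
      det (s \<cdot>\<^sub>m 1\<^sub>m (Suc m) + bordered_by_vec B c - all_ones_mat (Suc m))"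
  obtains Q where "Q \<in> carrier_mat m m" "Q\<^sup>T * Q = 1\<^sub>m m"
    "Q *\<^sub>v vec m (\<lambda>_. 1) = vec m (\<lambda>_. 1)" "Q\<^sup>T *\<^sub>v b = c" "Q\<^sup>T * A * Q = B"
proof -
  obtain es where es: "char_poly A = (\<Prod>e\<leftarrow>es. [:-e, 1:])"
    using char_poly_symmetric_mat_splits [OF A] .
  define d where "d = (!) es"
  obtain X where X: "X \<in> carrier_mat m m" "X\<^sup>T * X = 1\<^sub>m m" "X\<^sup>T * A * X = diagonal m d"
    using symmetric_mat_orthogonal_diagonalization [OF A es] unfolding d_def by blast
  \<comment> \<open>\<open>B\<close> is diagonalized along the same list \<open>es\<close>, so that
    one function \<open>d\<close> serves both matrices.\<close>
  obtain Y where Y: "Y \<in> carrier_mat m m" "Y\<^sup>T * Y = 1\<^sub>m m" "Y\<^sup>T * B * Y = diagonal m d"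
    using symmetric_mat_orthogonal_diagonalization [OF B] es char_poly unfolding d_def by metis
  interpret A: orthogonal_diagonalization m A X d using A X by unfold_locales
  interpret B: orthogonal_diagonalization m B Y d using B Y by unfold_locales
  define e where "e = vec m (\<lambda>_. 1 :: real)"
  have e: "e \<in> carrier_vec m" by (simp add: e_def)
  have dim: "dim_vec (X\<^sup>T *\<^sub>v u) = m" "dim_vec (Y\<^sup>T *\<^sub>v u) = m" for u
    using X Y by auto
  have ev: "eventually (\<lambda>s.
    resolvent_form d s (X\<^sup>T *\<^sub>v e) (X\<^sup>T *\<^sub>v e) = resolvent_form d s (Y\<^sup>T *\<^sub>v e) (Y\<^sup>T *\<^sub>v e) \<and>
    resolvent_form d s (X\<^sup>T *\<^sub>v b) (X\<^sup>T *\<^sub>v b) = resolvent_form d s (Y\<^sup>T *\<^sub>v c) (Y\<^sup>T *\<^sub>v c) \<and>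
    resolvent_form d s (X\<^sup>T *\<^sub>v e) (X\<^sup>T *\<^sub>v b) = resolvent_form d s (Y\<^sup>T *\<^sub>v e) (Y\<^sup>T *\<^sub>v c)) at_top"
    unfolding e_def using resolvent_forms_eq [OF A.orthogonal_diagonalization_axioms
        B.orthogonal_diagonalization_axioms b c eq eqJ beq beqJ] .
  obtain Z where Z: "Z \<in> carrier_mat m m" "Z\<^sup>T * Z = 1\<^sub>m m" "Z * diagonal m d = diagonal m d * Z"
    and Ze: "Z *\<^sub>v (Y\<^sup>T *\<^sub>v e) = X\<^sup>T *\<^sub>v e" and Zc: "Z *\<^sub>v (Y\<^sup>T *\<^sub>v c) = X\<^sup>T *\<^sub>v b"
  proof (rule orthogonal_matching_commuting_with_diagonal
      [of "X\<^sup>T *\<^sub>v e" m "X\<^sup>T *\<^sub>v b" "Y\<^sup>T *\<^sub>v e" "Y\<^sup>T *\<^sub>v c" d])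
    show "X\<^sup>T *\<^sub>v e \<in> carrier_vec m" "X\<^sup>T *\<^sub>v b \<in> carrier_vec m"
      "Y\<^sup>T *\<^sub>v e \<in> carrier_vec m" "Y\<^sup>T *\<^sub>v c \<in> carrier_vec m"
      using dim by (auto intro: carrier_vecI)
    show "block_scalar_prod d x (X\<^sup>T *\<^sub>v e) (X\<^sup>T *\<^sub>v e) = block_scalar_prod d x (Y\<^sup>T *\<^sub>v e) (Y\<^sup>T *\<^sub>v e)"
      "block_scalar_prod d x (X\<^sup>T *\<^sub>v e) (X\<^sup>T *\<^sub>v b) = block_scalar_prod d x (Y\<^sup>T *\<^sub>v e) (Y\<^sup>T *\<^sub>v c)"
      "block_scalar_prod d x (X\<^sup>T *\<^sub>v b) (X\<^sup>T *\<^sub>v b) = block_scalar_prod d x (Y\<^sup>T *\<^sub>v c) (Y\<^sup>T *\<^sub>v c)" for x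
      by (rule block_scalar_prod_eqI [of _ m], rule dim, rule dim,
          rule eventually_mono [OF ev], blast)+
  qed
  \<comment> \<open>\<open>Y\<^sup>T\<close> passes to eigencoordinates of \<open>B\<close>,
    \<open>Z\<close> matches them with those of \<open>A\<close>, and \<open>X\<close> returns.
    Hence \<open>Q\<close> fixes \<open>e\<close> and sends \<open>c\<close> to
    \<open>b\<close>.\<close>
  define Q where "Q = X * Z * Y\<^sup>T"
  have XZ: "X * Z \<in> carrier_mat m m" using X Z by simp
  have Q: "Q \<in> carrier_mat m m" using XZ Y by (simp add: Q_def)
  have QT: "Q\<^sup>T = Y * Z\<^sup>T * X\<^sup>T"
    using X Y Z XZ by (simp add: Q_def transpose_mult [of _ m m _ m] assoc_mult_mat [of _ m m _ m _ m])
  note assoc = assoc_mult_mat [of _ m m _ m _ m] mult_carrier_mat [of _ m m]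
  have "Q\<^sup>T * Q = Y * (Z\<^sup>T * ((X\<^sup>T * X) * Z)) * Y\<^sup>T"
    using X(1) Y(1) Z(1) by (simp add: QT assoc) (simp add: Q_def assoc)
  also have "\<dots> = 1\<^sub>m m" using Z by (simp add: X(2) B.orth' left_mult_one_mat [of _ m m] right_mult_one_mat [of _ m m] Y(1))
  finally have QQ: "Q\<^sup>T * Q = 1\<^sub>m m" .
  have QQ': "Q * Q\<^sup>T = 1\<^sub>m m"
    by (rule mat_mult_left_right_inverse [of _ m]) (use Q QQ in auto)
  have Qv: "Q *\<^sub>v u = X *\<^sub>v (Z *\<^sub>v (Y\<^sup>T *\<^sub>v u))" if "u \<in> carrier_vec m" for u
    using that X(1) Y(1) Z(1) XZ
    by (simp add: Q_def assoc_mult_mat_vec [of _ m m _ m] mult_mat_vec_carrier [of _ m m])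
  have XX: "X *\<^sub>v (X\<^sup>T *\<^sub>v u) = u" if "u \<in> carrier_vec m" for u
    using that X(1) A.orth' by (simp flip: assoc_mult_mat_vec [of _ m m _ m])
  have "Q\<^sup>T *\<^sub>v b = Q\<^sup>T *\<^sub>v (Q *\<^sub>v c)" using Qv [OF c] XX [OF b] by (simp add: Zc)
  also have "\<dots> = c" using Q c QQ by (simp flip: assoc_mult_mat_vec [of _ m m _ m])
  finally have Qb: "Q\<^sup>T *\<^sub>v b = c" .
  have "Q\<^sup>T * A * Q = Y * (Z\<^sup>T * ((X\<^sup>T * A * X) * Z)) * Y\<^sup>T"
    using X(1) Y(1) Z(1) A(1) by (simp add: QT assoc) (simp add: Q_def assoc)
  \<comment> \<open>Since \<open>Z\<close> commutes with the diagonal matrix, it can be moved next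
    to \<open>Z\<^sup>T\<close> and cancelled.\<close>
  also have "Z\<^sup>T * ((X\<^sup>T * A * X) * Z) = (Z\<^sup>T * Z) * diagonal m d"
    unfolding X(3) Z(3) [symmetric] using Z(1) by (simp add: assoc)
  also have "Y * ((Z\<^sup>T * Z) * diagonal m d) * Y\<^sup>T = B"
    using Z(2) B.A_eq by (simp add: left_mult_one_mat [of _ m m])
  finally have QAQ: "Q\<^sup>T * A * Q = B" .
  have "Q *\<^sub>v e = e" using Qv [OF e] XX [OF e] by (simp add: Ze)
  then show ?thesis
    unfolding e_def using that [OF Q QQ _ Qb QAQ] by blast
qed

section \<open>Graphs and their adjacency matrices\<close>

lemma all_ones_mat_carrier [simp]: "all_ones_mat n \<in> carrier_mat n n"
  by (simp add: all_ones_mat_def)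

definition complement_mat :: "real mat \<Rightarrow> real mat" where
  "complement_mat A = all_ones_mat (dim_row A) - 1\<^sub>m (dim_row A) - A"

lemma complement_mat_carrier [simp]:
  "A \<in> carrier_mat n n \<Longrightarrow> complement_mat A \<in> carrier_mat n n"
  by (auto simp: complement_mat_def)

lemma adjacency_matrix_carrier [simp]:
  "length us = n \<Longrightarrow> adjacency_matrix G us \<in> carrier_mat n n"
  by (simp add: adjacency_matrix_def)

lemma transpose_adjacency_matrix:
  assumes "graph G"
  shows "(adjacency_matrix G us)\<^sup>T = adjacency_matrix G us"
proof -
  interpret graph G by fact
  have "u \<rightarrow>\<^bsub>G\<^esub> v \<longleftrightarrow> v \<rightarrow>\<^bsub>G\<^esub> u" for u v
    using arcs_ends_symmetric [OF sym_arcs] by blast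
  then show ?thesis by (intro eq_matI) (auto simp: adjacency_matrix_def)
qed

lemma vertex_ordering_graph_complement:
  "vertex_ordering (graph_complement G) us = vertex_ordering G us"
  by (simp add: vertex_ordering_def graph_complement_def)

lemma adjacency_matrix_graph_complement:
  assumes "graph G" and us: "vertex_ordering G us"
  shows "adjacency_matrix (graph_complement G) us = complement_mat (adjacency_matrix G us)"
proof -
  interpret graph G by fact
  have dom: "u \<rightarrow>\<^bsub>graph_complement G\<^esub> v \<longleftrightarrow> u \<in> verts G \<and> v \<in> verts G \<and> u \<noteq> v \<and> \<not> u \<rightarrow>\<^bsub>G\<^esub> v" for u v
    by (force simp: graph_complement_def arcs_ends_def arc_to_ends_def)
  have "us ! i \<in> verts G" if "i < length us" for i
    using that us nth_mem by (auto simp: vertex_ordering_def)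
  moreover have "us ! i = us ! j \<longleftrightarrow> i = j" if "i < length us" "j < length us" for i j
    using that us by (simp add: vertex_ordering_def nth_eq_iff_index_eq)
  ultimately show ?thesis
    using adj_not_same
    by (intro eq_matI) (auto simp: adjacency_matrix_def complement_mat_def all_ones_mat_def dom)
qed

lemma vertex_ordering_delete_vertex:
  "vertex_ordering G (us @ [u]) \<Longrightarrow> vertex_ordering (delete_vertex G u) us"
  by (auto simp: vertex_ordering_def pre_digraph.verts_del_vert)

lemma adjacency_matrix_delete_vertex:
  assumes "u \<notin> set us"
  shows "adjacency_matrix (delete_vertex G u) us = adjacency_matrix G us"
proof -
  have "a \<rightarrow>\<^bsub>delete_vertex G u\<^esub> b \<longleftrightarrow> a \<rightarrow>\<^bsub>G\<^esub> b \<and> a \<noteq> u \<and> b \<noteq> u" for a b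
    by (auto simp: arcs_ends_conv pre_digraph.del_vert_simps)
  moreover have "us ! i \<noteq> u" if "i < length us" for i
    using that assms by auto
  ultimately show ?thesis
    by (intro eq_matI) (auto simp: adjacency_matrix_def)
qed

lemma adjacency_matrix_snoc:
  assumes "graph G"
  shows "adjacency_matrix G (us @ [u]) = bordered_by_vec (adjacency_matrix G us)
    (vec (length us) (\<lambda>i. if us ! i \<rightarrow>\<^bsub>G\<^esub> u then 1 else 0))"
proof -
  interpret graph G by fact
  have "v \<rightarrow>\<^bsub>G\<^esub> w \<longleftrightarrow> w \<rightarrow>\<^bsub>G\<^esub> v" for v w
    using arcs_ends_symmetric [OF sym_arcs] by blast
  then show ?thesis
    using adj_not_same
    by (intro eq_matI) (auto simp: adjacency_matrix_def bordered_by_vec_def mat_of_cols_def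
        mat_of_rows_def nth_append less_Suc_eq)
qed

section \<open>Spectra, characteristic polynomials and shifted determinants\<close>

lemma prod_proots_complex:
  fixes p :: "complex poly"
  assumes "lead_coeff p = 1"
  shows "p = (\<Prod>a\<in>#proots p. [:-a, 1:])"
proof -
  obtain as where as: "p = (\<Prod>a\<leftarrow>as. [:-a, 1:])"
    using fundamental_theorem_algebra_factorized [of p] assms by auto
  have "proots (\<Prod>a\<leftarrow>as. [:-a, 1:]) = mset as"
  proof (induction as)
    case (Cons a as)
    have "(\<Prod>a\<leftarrow>as. [:-a, 1:]) \<noteq> 0" by (auto simp: prod_list_zero_iff)
    then have "proots ([:-a, 1:] * (\<Prod>a\<leftarrow>as. [:-a, 1:])) = {#a#} + proots (\<Prod>a\<leftarrow>as. [:-a, 1:])"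
      by (subst proots_mult) auto
    then show ?case using Cons by simp
  qed simp
  then show ?thesis by (simp add: as prod_mset_prod_list flip: mset_map)
qed

text \<open>A monic complex polynomial is recovered from its roots with multiplicity, so equal
  spectra mean equal complex characteristic polynomials. Injectivity of the embedding of real
  polynomials brings the equality down to the reals.\<close>

lemma cospectral_iff_char_poly:
  assumes us: "vertex_ordering G us" and vs: "vertex_ordering H vs"
  shows "cospectral G H \<longleftrightarrow>
    char_poly (adjacency_matrix G us :: real mat) = char_poly (adjacency_matrix H vs)"
proof -
  interpret h: map_poly_inj_idom_hom complex_of_real ..
  have hom: "char_poly (adjacency_matrix K ws :: complex mat) =
      map_poly complex_of_real (char_poly (adjacency_matrix K ws))"
    for K :: "('x, 'y) pre_digraph" and ws
  proof -
    have "(adjacency_matrix K ws :: complex mat) = map_mat complex_of_real (adjacency_matrix K ws)"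
      by (rule eq_matI) (auto simp: adjacency_matrix_def)
    then show ?thesis
      using of_real_hom.char_poly_hom [of "adjacency_matrix K ws :: real mat" "length ws"] by simp
  qed
  have monic: "lead_coeff (char_poly (adjacency_matrix K ws :: complex mat)) = 1"
    for K :: "('x, 'y) pre_digraph" and ws
    using degree_monic_char_poly [of "adjacency_matrix K ws :: complex mat" "length ws"] by simp
  have "cospectral G H \<longleftrightarrow>
      char_poly (adjacency_matrix G us :: complex mat) = char_poly (adjacency_matrix H vs)"
    unfolding cospectral_def graph_spectrum_eq [OF us] graph_spectrum_eq [OF vs]
    using prod_proots_complex [OF monic] by metis
  then show ?thesis by (simp only: hom h.eq_iff)
qed

lemma det_shift_eq_char_poly:
  fixes A :: "real mat"
  assumes A: "A \<in> carrier_mat n n"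
  shows "det (s \<cdot>\<^sub>m 1\<^sub>m n + A) = (-1) ^ n * poly (char_poly A) (-s)"
proof -
  have "s \<cdot>\<^sub>m 1\<^sub>m n + A = -1 \<cdot>\<^sub>m (- char_matrix A (-s))"
    by (rule eq_matI) (use A in \<open>auto simp: char_matrix_def\<close>)
  then show ?thesis
    using A by (simp only: det_smult char_poly_matrix [OF A]) (simp add: char_matrix_def)
qed

text \<open>\<open>complement_mat A\<close> minus \<open>s - 1\<close> times the identity is the
  negative of the matrix on the left; the identity subtracted in \<open>complement_mat\<close>
  causes the shift by 1.\<close>

lemma det_shift_minus_all_ones_eq_char_poly:
  fixes A :: "real mat"
  assumes A: "A \<in> carrier_mat n n"
  shows "det (s \<cdot>\<^sub>m 1\<^sub>m n + A - all_ones_mat n) = poly (char_poly (complement_mat A)) (s - 1)"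
proof -
  have "s \<cdot>\<^sub>m 1\<^sub>m n + A - all_ones_mat n = - char_matrix (complement_mat A) (s - 1)"
    by (rule eq_matI) (use A in \<open>auto simp: char_matrix_def complement_mat_def all_ones_mat_def\<close>)
  then show ?thesis
    using A by (simp add: char_poly_matrix [of _ n])
qed

section \<open>Regular orthogonal matrices and bordering\<close>

lemma regular_orthogonal_mat_iff:
  assumes Q: "Q \<in> carrier_mat m m"
  shows "regular_orthogonal_mat Q \<longleftrightarrow> Q\<^sup>T * Q = 1\<^sub>m m \<and> Q *\<^sub>v vec m (\<lambda>_. 1) = vec m (\<lambda>_. 1)"
proof -
  have "Q *\<^sub>v vec m (\<lambda>_. 1) = vec m (\<lambda>_. 1) \<longleftrightarrow> (\<forall>i<m. (\<Sum>j<m. Q $$ (i, j)) = 1)"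
    using Q by (auto simp: vec_eq_iff scalar_prod_def atLeast0LessThan)
  moreover have "Q * Q\<^sup>T = 1\<^sub>m m" if "Q\<^sup>T * Q = 1\<^sub>m m"
    by (rule mat_mult_left_right_inverse [of _ m]) (use Q that in auto)
  ultimately show ?thesis
    using Q by (auto simp: regular_orthogonal_mat_def inverts_mat_def)
qed

lemma bordered_mat_carrier [simp]:
  "Q \<in> carrier_mat m m \<Longrightarrow> bordered_mat Q \<in> carrier_mat (Suc m) (Suc m)"
  by (auto simp: bordered_mat_def)

lemma bordered_mat_transpose:
  "Q \<in> carrier_mat m m \<Longrightarrow> bordered_mat Q\<^sup>T = (bordered_mat Q)\<^sup>T"
  by (rule eq_matI) (auto simp: bordered_mat_def)

lemma bordered_mat_mult:
  assumes "P \<in> carrier_mat m m" "Q \<in> carrier_mat m m"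
  shows "bordered_mat P * bordered_mat Q = bordered_mat (P * Q)"
  using mult_block_diagonal_mat [of P m "1\<^sub>m 1" 1 Q "1\<^sub>m 1"] assms by (simp add: bordered_mat_def)

lemma bordered_mat_eq_one_iff:
  assumes "Q \<in> carrier_mat m m"
  shows "bordered_mat Q = 1\<^sub>m (Suc m) \<longleftrightarrow> Q = 1\<^sub>m m"
proof
  assume *: "bordered_mat Q = 1\<^sub>m (Suc m)"
  show "Q = 1\<^sub>m m"
  proof (rule eq_matI)
    fix i j assume "i < dim_row (1\<^sub>m m :: real mat)" "j < dim_col (1\<^sub>m m :: real mat)"
    then show "Q $$ (i, j) = 1\<^sub>m m $$ (i, j)"
      using assms arg_cong [OF *, of "\<lambda>M. M $$ (i, j)"] by (simp add: bordered_mat_def)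
  qed (use assms in auto)
next
  assume "Q = 1\<^sub>m m"
  then show "bordered_mat Q = 1\<^sub>m (Suc m)" by (auto simp: bordered_mat_def intro!: eq_matI)
qed

text \<open>The added row has sum 1 and the other rows only gain a 0, so row sums carry over in both
  directions; orthogonality is checked block by block.\<close>

lemma regular_orthogonal_bordered_mat_iff:
  assumes Q: "Q \<in> carrier_mat m m"
  shows "regular_orthogonal_mat (bordered_mat Q) \<longleftrightarrow> regular_orthogonal_mat Q"
proof -
  have "(bordered_mat Q *\<^sub>v vec (Suc m) (\<lambda>_. 1)) $ i =
      (if i < m then (Q *\<^sub>v vec m (\<lambda>_. 1)) $ i else 1)" if "i < Suc m" for i
    using that Q by (auto simp: bordered_mat_def scalar_prod_def less_Suc_eq)
  then have "bordered_mat Q *\<^sub>v vec (Suc m) (\<lambda>_. 1) = vec (Suc m) (\<lambda>_. 1) \<longleftrightarrow>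
      Q *\<^sub>v vec m (\<lambda>_. 1) = vec m (\<lambda>_. 1)"
    using Q carrier_matD [OF bordered_mat_carrier [OF Q]]
    by (auto simp: vec_eq_iff less_Suc_eq simp del: index_mult_mat_vec)
  moreover have "(bordered_mat Q)\<^sup>T * bordered_mat Q = 1\<^sub>m (Suc m) \<longleftrightarrow> Q\<^sup>T * Q = 1\<^sub>m m"
    using Q by (simp add: bordered_mat_mult bordered_mat_eq_one_iff flip: bordered_mat_transpose)
  ultimately show ?thesis
    using Q by (simp add: regular_orthogonal_mat_iff [of _ m] regular_orthogonal_mat_iff [of _ "Suc m"])
qed

text \<open>The corner 1 of \<open>bordered_mat Q\<close> makes the border transform as a vector, so
  that one congruence encodes both \<open>Q\<^sup>T * A * Q\<close> and
  \<open>Q\<^sup>T *\<^sub>v b\<close>.\<close>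

lemma bordered_mat_congruence:
  assumes Q: "Q \<in> carrier_mat m m" and A: "A \<in> carrier_mat m m" and b: "b \<in> carrier_vec m"
  shows "bordered_mat Q\<^sup>T * bordered_by_vec A b * bordered_mat Q =
    bordered_by_vec (Q\<^sup>T * A * Q) (Q\<^sup>T *\<^sub>v b)"
proof -
  have QA: "Q\<^sup>T * A \<in> carrier_mat m m" using Q A by simp
  have Qb: "Q\<^sup>T * mat_of_cols m [b] = mat_of_cols m [Q\<^sup>T *\<^sub>v b]"
    by (rule eq_matI) (use Q b in \<open>auto simp: mat_of_cols_def scalar_prod_def\<close>)
  have bQ: "mat_of_rows m [b] * Q = mat_of_rows m [Q\<^sup>T *\<^sub>v b]"
    by (rule eq_matI) (use Q b in \<open>auto simp: mat_of_rows_def scalar_prod_def mult.commute\<close>)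
  have cols: "mat_of_cols m [v] \<in> carrier_mat m 1" and rows: "mat_of_rows m [v] \<in> carrier_mat 1 m"
    for v :: "real vec" by auto
  have "bordered_mat Q\<^sup>T * bordered_by_vec A b =
      four_block_mat (Q\<^sup>T * A) (Q\<^sup>T * mat_of_cols m [b]) (mat_of_rows m [b]) (0\<^sub>m 1 1)"
    unfolding bordered_mat_def bordered_by_vec_def using Q A b
    by (subst mult_four_block_mat [of _ m m _ 1 _ 1 _ _ m _ 1]) auto
  moreover have "four_block_mat (Q\<^sup>T * A) (mat_of_cols m [Q\<^sup>T *\<^sub>v b]) (mat_of_rows m [b]) (0\<^sub>m 1 1) *
      four_block_mat Q (0\<^sub>m m 1) (0\<^sub>m 1 m) (1\<^sub>m 1) =
      four_block_mat (Q\<^sup>T * A * Q) (mat_of_cols m [Q\<^sup>T *\<^sub>v b]) (mat_of_rows m [b] * Q) (0\<^sub>m 1 1)"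
    unfolding mult_four_block_mat [OF QA cols rows zero_carrier_mat Q zero_carrier_mat
        zero_carrier_mat one_carrier_mat]
  proof (rule cong_four_block_mat)
    show "Q\<^sup>T * A * Q + mat_of_cols m [Q\<^sup>T *\<^sub>v b] * 0\<^sub>m 1 m = Q\<^sup>T * A * Q"
      using mult_carrier_mat [OF QA Q] by (simp only: right_mult_zero_mat [OF cols] right_add_zero_mat)
    show "Q\<^sup>T * A * 0\<^sub>m m 1 + mat_of_cols m [Q\<^sup>T *\<^sub>v b] * 1\<^sub>m 1 = mat_of_cols m [Q\<^sup>T *\<^sub>v b]"
      by (simp only: right_mult_zero_mat [OF QA] right_mult_one_mat [OF cols] left_add_zero_mat [OF cols])
    show "mat_of_rows m [b] * Q + 0\<^sub>m 1 1 * 0\<^sub>m 1 m = mat_of_rows m [b] * Q"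
      using mult_carrier_mat [OF rows Q] by (simp only: left_mult_zero_mat [OF zero_carrier_mat] right_add_zero_mat)
    show "mat_of_rows m [b] * 0\<^sub>m m 1 + 0\<^sub>m 1 1 * 1\<^sub>m 1 = 0\<^sub>m 1 1"
      by (simp only: right_mult_zero_mat [OF rows] left_mult_zero_mat [OF one_carrier_mat] left_add_zero_mat [OF zero_carrier_mat])
  qed
  ultimately have "bordered_mat Q\<^sup>T * bordered_by_vec A b * bordered_mat Q =
      four_block_mat (Q\<^sup>T * A * Q) (mat_of_cols m [Q\<^sup>T *\<^sub>v b]) (mat_of_rows m [b] * Q) (0\<^sub>m 1 1)"
    using Q unfolding Qb by (simp add: bordered_mat_def)
  then show ?thesis using Q b by (simp add: bordered_by_vec_def bQ)
qed

lemma bordered_by_vec_eqD: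
  assumes "A \<in> carrier_mat m m" "B \<in> carrier_mat m m" "b \<in> carrier_vec m" "c \<in> carrier_vec m"
    and eq: "bordered_by_vec A b = bordered_by_vec B c"
  shows "A = B"
proof (rule eq_matI)
  have entry: "bordered_by_vec M w $$ (i, j) = M $$ (i, j)"
    if "M \<in> carrier_mat m m" "i < m" "j < m" for M w i j
    using that by (simp add: bordered_by_vec_def)
  fix i j assume "i < dim_row B" "j < dim_col B"
  then show "A $$ (i, j) = B $$ (i, j)"
    using entry [of A i j b] entry [of B i j c] assms by simp
qed (use assms in auto)

text \<open>Orthogonal congruence is a similarity. Regularity makes it preserve the all-ones matrix
  besides the identity, so it carries complements to complements.\<close>

lemma char_poly_regular_orthogonal_congruence:
  assumes A: "A \<in> carrier_mat n n" and Q: "Q \<in> carrier_mat n n" and reg: "regular_orthogonal_mat Q"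
  shows "char_poly (Q\<^sup>T * A * Q) = char_poly A"
    and "char_poly (complement_mat (Q\<^sup>T * A * Q)) = char_poly (complement_mat A)"
proof -
  let ?e = "vec n (\<lambda>_. 1 :: real)" and ?J = "all_ones_mat n"
  have QQ: "Q\<^sup>T * Q = 1\<^sub>m n" and Qe: "Q *\<^sub>v ?e = ?e"
    using reg regular_orthogonal_mat_iff [OF Q] by auto
  have QQ': "Q * Q\<^sup>T = 1\<^sub>m n"
    by (rule mat_mult_left_right_inverse [of _ n]) (use Q QQ in auto)
  show "char_poly (Q\<^sup>T * A * Q) = char_poly A"
    by (rule char_poly_orthogonal_similar [OF A Q QQ QQ'])
  \<comment> \<open>\<open>Q\<^sup>T\<close> inverts \<open>Q\<close>, so it fixes the all-ones
    vector too: the column sums are also 1.\<close>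
  have "Q\<^sup>T *\<^sub>v ?e = Q\<^sup>T *\<^sub>v (Q *\<^sub>v ?e)" by (simp add: Qe)
  also have "\<dots> = ?e" using Q by (simp add: QQ flip: assoc_mult_mat_vec [of _ n n _ n])
  finally have Qe': "Q\<^sup>T *\<^sub>v ?e = ?e" .
  have JQ: "?J * Q = ?J"
  proof (rule eq_matI)
    fix i j assume "i < dim_row ?J" "j < dim_col ?J"
    then show "(?J * Q) $$ (i, j) = ?J $$ (i, j)"
      using Q arg_cong [OF Qe', of "\<lambda>v. v $ j"] by (simp add: all_ones_mat_def scalar_prod_def)
  qed (use Q in \<open>auto simp: all_ones_mat_def\<close>)
  have JT: "?J\<^sup>T = ?J" by (rule eq_matI) (auto simp: all_ones_mat_def)
  have QJ: "Q\<^sup>T * ?J = ?J"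
    using arg_cong [OF JQ, of transpose_mat] Q by (simp add: transpose_mult [of _ n n _ n] JT)
  have QA: "Q\<^sup>T * A \<in> carrier_mat n n" using Q A by simp
  have "Q\<^sup>T * (?J - 1\<^sub>m n - A) * Q = (Q\<^sup>T * ?J - Q\<^sup>T * 1\<^sub>m n - Q\<^sup>T * A) * Q"
    using Q A by (simp add: mult_minus_distrib_mat [of _ n n _ n] minus_carrier_mat)
  also have "\<dots> = Q\<^sup>T * ?J * Q - Q\<^sup>T * 1\<^sub>m n * Q - Q\<^sup>T * A * Q"
    using Q QA by (simp add: minus_mult_distrib_mat [of _ n n _ _ n] minus_carrier_mat mult_carrier_mat [of _ n n])
  also have "\<dots> = ?J - 1\<^sub>m n - Q\<^sup>T * A * Q"
    using Q by (simp add: QJ JQ QQ right_mult_one_mat [of _ n n])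
  finally have "Q\<^sup>T * complement_mat A * Q = complement_mat (Q\<^sup>T * A * Q)"
    using A Q by (simp add: complement_mat_def)
  then show "char_poly (complement_mat (Q\<^sup>T * A * Q)) = char_poly (complement_mat A)"
    using char_poly_orthogonal_similar [OF complement_mat_carrier [OF A] Q QQ QQ'] by simp
qed

section \<open>The equivalence for rooted graphs\<close>

lemma rooted_generalized_cospectral_iff_char_poly:
  assumes G: "graph G" and H: "graph H"
    and us: "vertex_ordering G (us @ [u])" and vs: "vertex_ordering H (vs @ [v])"
  defines "A \<equiv> adjacency_matrix G us" and "B \<equiv> adjacency_matrix H vs"
    and "A' \<equiv> adjacency_matrix G (us @ [u])" and "B' \<equiv> adjacency_matrix H (vs @ [v])"
  shows "rooted_generalized_cospectral (G, u) (H, v) \<longleftrightarrow>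
    char_poly A' = char_poly B' \<and> char_poly (complement_mat A') = char_poly (complement_mat B') \<and>
    char_poly A = char_poly B \<and> char_poly (complement_mat A) = char_poly (complement_mat B)"
proof -
  note us' = vertex_ordering_delete_vertex [OF us] and vs' = vertex_ordering_delete_vertex [OF vs]
  have "u \<notin> set us" "v \<notin> set vs" using us vs by (auto simp: vertex_ordering_def)
  \<comment> \<open>With the root listed last, deleting it truncates the ordering and keeps all
    adjacencies among the other vertices, so \<open>G\<close> and \<open>H\<close> themselves can
    supply these matrices.\<close>
  then have del: "adjacency_matrix (delete_vertex G u) us = A"
    "adjacency_matrix (delete_vertex H v) vs = B"
    by (simp_all add: A_def B_def adjacency_matrix_delete_vertex)
  have co: "cospectral (graph_complement K) (graph_complement L) \<longleftrightarrow>
      char_poly (complement_mat (adjacency_matrix K ks)) = char_poly (complement_mat (adjacency_matrix L ls))"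
    if "graph K" "graph L" "vertex_ordering K ks" "vertex_ordering L ls"
    for K :: "('a, 'b) pre_digraph" and L :: "('c, 'd) pre_digraph" and ks ls
    using that by (subst cospectral_iff_char_poly [of _ ks _ ls])
      (simp_all add: vertex_ordering_graph_complement adjacency_matrix_graph_complement)
  show ?thesis
    using co [OF G H us vs] co [OF graph_delete_vertex [OF G] graph_delete_vertex [OF H] us' vs']
      cospectral_iff_char_poly [OF us vs] cospectral_iff_char_poly [OF us' vs']
    unfolding del A'_def [symmetric] B'_def [symmetric]
    by (auto simp: rooted_generalized_cospectral_def generalized_cospectral_def)
qed

theorem theorem3:
  fixes G :: "('a, 'b) pre_digraph" and H :: "('c, 'd) pre_digraph"
    and us :: "'a list" and vs :: "'c list" and n :: nat
  assumes "graph G" and "graph H"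
    and "vertex_ordering G us" and "vertex_ordering H vs"
    and "length us = n" and "length vs = n" and "n \<ge> 1"
  shows "rooted_generalized_cospectral (G, us ! (n - 1)) (H, vs ! (n - 1)) \<longleftrightarrow>
    (\<exists>Q \<in> carrier_mat (n - 1) (n - 1).
       regular_orthogonal_mat (bordered_mat Q) \<and>
       bordered_mat (transpose_mat Q) * adjacency_matrix G us * bordered_mat Q
         = adjacency_matrix H vs)"
proof -
  define m where "m = n - 1"
  have n: "n = Suc m" using assms(7) by (simp add: m_def)
  define us' u vs' v where "us' = butlast us" and "u = last us" and "vs' = butlast vs" and "v = last vs"
  have us: "us = us' @ [u]" and vs: "vs = vs' @ [v]"
    using assms(5,6) n unfolding us'_def u_def vs'_def v_def
    by (metis append_butlast_last_id length_0_conv nat.distinct(1))+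
  have len: "length us' = m" "length vs' = m" using assms(5,6) n us vs by auto
  have nth: "us ! (n - 1) = u" "vs ! (n - 1) = v" using len n us vs by (simp_all add: nth_append)
  define A B :: "real mat" where "A = adjacency_matrix G us'" and "B = adjacency_matrix H vs'"
  define b c :: "real vec" where "b = vec m (\<lambda>i. if us' ! i \<rightarrow>\<^bsub>G\<^esub> u then 1 else 0)"
    and "c = vec m (\<lambda>i. if vs' ! i \<rightarrow>\<^bsub>H\<^esub> v then 1 else 0)"
  have A: "A \<in> carrier_mat m m" "A\<^sup>T = A" and B: "B \<in> carrier_mat m m" "B\<^sup>T = B"
    unfolding A_def B_def using len assms(1,2) by (auto intro: transpose_adjacency_matrix)
  have b: "b \<in> carrier_vec m" and c: "c \<in> carrier_vec m" by (simp_all add: b_def c_def)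
  have A': "adjacency_matrix G us = bordered_by_vec A b"
    and B': "adjacency_matrix H vs = bordered_by_vec B c"
    using adjacency_matrix_snoc [OF assms(1), of us' u] adjacency_matrix_snoc [OF assms(2), of vs' v]
    by (simp_all add: us vs A_def B_def b_def c_def len)
  have bA: "bordered_by_vec A b \<in> carrier_mat (Suc m) (Suc m)"
    and bB: "bordered_by_vec B c \<in> carrier_mat (Suc m) (Suc m)"
    using assms(5,6) by (simp_all flip: A' B' n)
  have iff: "rooted_generalized_cospectral (G, us ! (n - 1)) (H, vs ! (n - 1)) \<longleftrightarrow>
    char_poly (bordered_by_vec A b) = char_poly (bordered_by_vec B c) \<and>
    char_poly (complement_mat (bordered_by_vec A b)) =
      char_poly (complement_mat (bordered_by_vec B c)) \<and>
    char_poly A = char_poly B \<and> char_poly (complement_mat A) = char_poly (complement_mat B)"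
    using rooted_generalized_cospectral_iff_char_poly [OF assms(1,2), of us' u vs' v] assms(3,4)
    unfolding nth us [symmetric] vs [symmetric] A' B' A_def [symmetric] B_def [symmetric] by blast
  show ?thesis
    unfolding iff unfolding A' B' m_def [symmetric]
  proof (intro iffI, goal_cases)
    case 1
    \<comment> \<open>The four equalities of characteristic polynomials become determinant
      identities in \<open>s\<close>; those for complements have the all-ones matrix
      subtracted.\<close>
    then have "det (s \<cdot>\<^sub>m 1\<^sub>m m + A) = det (s \<cdot>\<^sub>m 1\<^sub>m m + B)"
      "det (s \<cdot>\<^sub>m 1\<^sub>m m + A - all_ones_mat m) = det (s \<cdot>\<^sub>m 1\<^sub>m m + B - all_ones_mat m)"
      "det (s \<cdot>\<^sub>m 1\<^sub>m (Suc m) + bordered_by_vec A b) =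
        det (s \<cdot>\<^sub>m 1\<^sub>m (Suc m) + bordered_by_vec B c)"
      "det (s \<cdot>\<^sub>m 1\<^sub>m (Suc m) + bordered_by_vec A b - all_ones_mat (Suc m)) =
        det (s \<cdot>\<^sub>m 1\<^sub>m (Suc m) + bordered_by_vec B c - all_ones_mat (Suc m))" for s
      using A B bA bB
      by (simp_all only: det_shift_eq_char_poly det_shift_minus_all_ones_eq_char_poly)
    with 1 obtain Q where Q: "Q \<in> carrier_mat m m" "Q\<^sup>T * Q = 1\<^sub>m m"
      "Q *\<^sub>v vec m (\<lambda>_. 1) = vec m (\<lambda>_. 1)" and "Q\<^sup>T *\<^sub>v b = c" "Q\<^sup>T * A * Q = B"
      using orthogonal_similarity_of_bordered [OF A B _ b c] by metis
    then have "bordered_mat Q\<^sup>T * bordered_by_vec A b * bordered_mat Q = bordered_by_vec B c"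
      using bordered_mat_congruence [OF Q(1) A(1) b] by simp
    moreover have "regular_orthogonal_mat (bordered_mat Q)"
      using Q by (simp add: regular_orthogonal_bordered_mat_iff regular_orthogonal_mat_iff)
    ultimately show ?case using Q(1) by blast
  next
    case 2
    then obtain Q where Q: "Q \<in> carrier_mat m m" and reg: "regular_orthogonal_mat (bordered_mat Q)"
      and eq: "bordered_mat Q\<^sup>T * bordered_by_vec A b * bordered_mat Q = bordered_by_vec B c"
      by blast
    have "bordered_by_vec (Q\<^sup>T * A * Q) (Q\<^sup>T *\<^sub>v b) = bordered_by_vec B c"
      using bordered_mat_congruence [OF Q A(1) b] eq by simp
    \<comment> \<open>Comparing the upper left blocks gives the congruence between the
      vertex-deleted graphs.\<close>
    then have B_eq: "Q\<^sup>T * A * Q = B"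
      by (rule bordered_by_vec_eqD [rotated 4])
        (use A B Q b c in \<open>auto intro!: mult_carrier_mat [of _ m m] mult_mat_vec_carrier [of _ m m]\<close>)
    have "regular_orthogonal_mat Q" using reg Q by (simp add: regular_orthogonal_bordered_mat_iff)
    \<comment> \<open>\<open>Q\<close> takes care of the vertex-deleted graphs and their
      complements, \<open>bordered_mat Q\<close> of the full graphs and theirs.\<close>
    from char_poly_regular_orthogonal_congruence [OF A(1) Q this]
      char_poly_regular_orthogonal_congruence [OF bA bordered_mat_carrier [OF Q] reg]
    show ?case by (simp add: B_eq eq flip: bordered_mat_transpose [OF Q])
  qed
qed

end
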